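(* Let $\mathcal{Q}$ be a small quantaloid and $\mathbb{T}=(T,m,e)$ a monad on $\mathbf{Set}/\mathcal{Q}_0$. There is a bijective correspondence between the monotone distributive laws $\lambda$ of $\mathbb{T}$ over $\mathbb{P}_{\mathcal{Q}}$ and the lax extensions $\hat{T}$ of $\mathbb{T}$ to $\mathcal{Q}\text{-}\mathbf{Rel}$ (given by $\overleftarrow{\hat{T}\varphi}=\lambda_X\cdot T\overleftarrow{\varphi}$ for $\varphi\colon X\nrightarrow Y$, with inverse $\lambda_X=\overleftarrow{\hat{T}\varepsilon_X}$). These lax extensions are equivalently described as the monotone $(\mathbb{T},\mathcal{Q})$-extension families $\hat{T}$ satisfying the following inequalities for all $f\colon X\to Y$ in $\mathbf{Set}/\mathcal{Q}_0$ and $\varphi\colon X\nrightarrow Y$, $\psi\colon Y\nrightarrow Z$ in $\mathcal{Q}\text{-}\mathbf{Rel}$: 1. $(Tf)_{\circ}\le\hat{T}(f_{\circ})$; 2. $(Tf)^{\circ}\le\hat{T}(f^{\circ})$; 3. $\hat{T}\psi\circ\hat{T}\varphi\le\hat{T}(\psi\circ\varphi)$; 4. $(e_Y)_{\circ}\circ\varphi\le\hat{T}\varphi\circ(e_X)_{\circ}$; 5. $(m_Y)_{\circ}\circ\hat{T}\hat{T}\varphi\le\hat{T}\varphi\circ(m_X)_{\circ}$.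
   Context: A quantaloid is a category whose hom-sets are complete lattices and whose composition preserves arbitrary suprema in each variable. $\mathcal{Q}$ is a small quantaloid with object set $\mathcal{Q}_0$; $\bot$ denotes bottom elements. Objects of $\mathbf{Set}/\mathcal{Q}_0$ are sets $X$ with an array map $|\cdot|_X\colon X\to\mathcal{Q}_0$; morphisms are array-preserving maps. $\mathcal{Q}\text{-}\mathbf{Rel}$ has the same objects; a morphism ($\mathcal{Q}$-relation) $\varphi\colon X\nrightarrow Y$ is a family of $\mathcal{Q}$-morphisms $\varphi(x,y)\colon|x|\to|y|$, with $(\psi\circ\varphi)(x,z)=\bigvee_{y}\psi(y,z)\circ\varphi(x,y)$; hom-sets are ordered pointwise. For $f\colon X\to Y$ in $\mathbf{Set}/\mathcal{Q}_0$, $f_\circ\colon X\nrightarrow Y$ and $f^\circ\colon Y\nrightarrow X$ are given by $f_\circ(x,y)=f^\circ(y,x)=1_{|x|}$ if $f(x)=y$ and $\bot$ otherwise; $1_X^\circ$ is the identity $\mathcal{Q}$-relation. Discrete presheaf monad $\mathbb{P}_{\mathcal{Q}}=(\mathsf{P},\mathsf{s},\mathsf{y})$ on $\mathbf{Set}/\mathcal{Q}_0$: $\mathsf{P}X$ is the set of all families $\sigma=(\sigma_x\colon|x|\to s)_{x\in X}$ of $\mathcal{Q}$-morphisms with a specified common codomain $s=:|\sigma|$ (the array of $\sigma$), ordered by $\sigma\le\sigma'$ iff $|\sigma|=|\sigma'|$ and $\sigma_x\le\sigma'_x$ for all $x$; maps into $\mathsf{P}X$ are ordered pointwise. $\mathsf{P}f=f_!$,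 $(f_!\sigma)_y=\bigvee_{x\in f^{-1}y}\sigma_x$; $(\mathsf{y}_Xy)_x=1_{|y|}$ if $x=y$, else $\bot$; $(\mathsf{s}_X\Sigma)_x=\bigvee_{\sigma\in\mathsf{P}X}\Sigma_\sigma\circ\sigma_x$. For $\varphi\colon X\nrightarrow Y$, $\overleftarrow{\varphi}\colon Y\to\mathsf{P}X$ is $(\overleftarrow{\varphi}(y))_x=\varphi(x,y)$ (a bijection between $\mathcal{Q}$-relations $X\nrightarrow Y$ and morphisms $Y\to\mathsf{P}X$). $\varepsilon_X\colon X\nrightarrow\mathsf{P}X$ is $\varepsilon_X(x,\sigma)=\sigma_x$. A monotone distributive law of $\mathbb{T}$ over $\mathbb{P}_{\mathcal{Q}}$ is a family of morphisms $\lambda_X\colon T\mathsf{P}X\to\mathsf{P}TX$ in $\mathbf{Set}/\mathcal{Q}_0$ such that for all $X$ and $f\colon X\to Y$: (a) $(Tf)_!\cdot\lambda_X\le\lambda_Y\cdot T(f_!)$; (b) $\mathsf{y}_{TX}\le\lambda_X\cdot T\mathsf{y}_X$; (c) $\mathsf{s}_{TX}\cdot(\lambda_X)_!\cdot\lambda_{\mathsf{P}X}\le\lambda_X\cdot T\mathsf{s}_X$; (d) $(e_X)_!\le\lambda_X\cdot e_{\mathsf{P}X}$; (e) $(m_X)_!\cdot\lambda_{TX}\cdot T\lambda_X\le\lambda_X\cdot m_{\mathsf{P}X}$; and $f\le g\Rightarrow\lambda_X\cdot Tf\le\lambda_X\cdot Tg$ for all $f,g\colon Y\to\mathsf{P}X$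 in $\mathbf{Set}/\mathcal{Q}_0$. A $(\mathbb{T},\mathcal{Q})$-extension family is a family of $\mathcal{Q}$-relations $\hat{T}\varphi\colon TX\nrightarrow TY$, one for each $\varphi\colon X\nrightarrow Y$; it is monotone if $\varphi\le\varphi'$ implies $\hat{T}\varphi\le\hat{T}\varphi'$. A lax extension $\hat{T}$ of $\mathbb{T}$ to $\mathcal{Q}\text{-}\mathbf{Rel}$ is a monotone $(\mathbb{T},\mathcal{Q})$-extension family such that for all $\varphi\colon X\nrightarrow Y$, $\psi\colon Y\nrightarrow Z$ and $h\colon Z\to Y$ in $\mathbf{Set}/\mathcal{Q}_0$: $\hat{T}(h^\circ\circ\varphi)=(Th)^\circ\circ\hat{T}\varphi$; $1_{TX}^\circ\le\hat{T}(1_X^\circ)$; $\hat{T}\psi\circ\hat{T}\varphi\le\hat{T}(\psi\circ\varphi)$; $\varphi\circ e_X^\circ\le e_Y^\circ\circ\hat{T}\varphi$; $\hat{T}\hat{T}\varphi\circ m_X^\circ\le m_Y^\circ\circ\hat{T}\varphi$. *)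

theory Defs
  imports "HOL-Algebra.Complete_Lattice" "HOL-Library.FuncSet"
begin

section \<open>The ambient universe of sets\<close>

text \<open>
  No HOL type contains, for each of its subsets, all families over that subset, so the category
  of all sets (over a base) cannot be built over a plain type. We work inside an arbitrary
  Grothendieck universe: a type whose elements are sets of elements of the same type, with
  extensionality, foundation, separation, union, powerset and replacement, all in second-order
  form. ``Set'' means ``small set'', i.e. a HOL set that is the extension of an element.
  Infinity is not needed and not imposed: models of ZFC are instances, but so is the universe of
  hereditarily finite sets.
\<close>

class set_universe =
  fixes elts :: "'a \<Rightarrow> 'a set"
  assumes elts_inject: "elts x = elts y \<Longrightarrow> x = y"
    and elts_foundation: "wf {(x, y). x \<in> elts y}"
    and elts_separation: "A \<subseteq> elts x \<Longrightarrow> A \<in> range elts"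
    and elts_union: "(\<Union>y\<in>elts x. elts y) \<in> range elts"
    and elts_powerset: "{y. elts y \<subseteq> elts x} \<in> range elts"
    and elts_replacement: "f ` elts x \<in> range elts"

definition small :: "'v::set_universe set \<Rightarrow> bool" where
  "small A \<longleftrightarrow> A \<in> range elts"

definition vset :: "'v::set_universe set \<Rightarrow> 'v" where
  "vset A = (THE a. elts a = A)"

definition vpair :: "'v::set_universe \<Rightarrow> 'v \<Rightarrow> 'v" where
  "vpair x y = vset {vset {x}, vset {x, y}}"

text \<open>
  The element of the universe that is the family \<open>(\<sigma> x)\<close>, \<open>x \<in> A\<close>, together with a specified
  \<open>s\<close>: the pair of \<open>s\<close> and the set-theoretic graph of \<open>\<sigma>\<close> on \<open>A\<close>. It is decoded by
  \<open>fam_cod\<close> and \<open>fam_at\<close>.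
\<close>

definition fam :: "'v::set_universe set \<Rightarrow> 'v \<Rightarrow> ('v \<Rightarrow> 'v) \<Rightarrow> 'v" where
  "fam A s \<sigma> = vpair s (vset ((\<lambda>x. vpair x (\<sigma> x)) ` A))"

definition fam_cod :: "'v::set_universe \<Rightarrow> 'v" where
  "fam_cod p = (THE s. \<exists>g. p = vpair s g)"

definition fam_at :: "'v::set_universe \<Rightarrow> 'v \<Rightarrow> 'v" where
  "fam_at p x = (THE c. \<exists>s g. p = vpair s g \<and> vpair x c \<in> elts g)"

lemma small_elts: "small (elts x)"
  by (simp add: small_def)

lemma smallE:
  assumes "small A"
  obtains a where "A = elts a"
  using assms by (auto simp: small_def)

lemma vset_elts: "vset (elts a) = a"
  unfolding vset_def by (rule the_equality) (auto intro: elts_inject)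

lemma elts_vset: "small A \<Longrightarrow> elts (vset A) = A"
  by (auto elim!: smallE simp: vset_elts)

lemma small_subset: "small B \<Longrightarrow> A \<subseteq> B \<Longrightarrow> small A"
  by (erule smallE) (simp add: small_def elts_separation)

lemma small_image: "small (A :: 'v::set_universe set) \<Longrightarrow> small ((f :: 'v \<Rightarrow> 'v) ` A)"
  by (erule smallE) (simp only: small_def elts_replacement)

lemma small_Pow: "small A \<Longrightarrow> small {a. elts a \<subseteq> A}"
  by (erule smallE) (simp only: small_def elts_powerset)

lemma small_UN:
  fixes F :: "'v::set_universe \<Rightarrow> 'v set"
  assumes "small A" and "\<And>x. x \<in> A \<Longrightarrow> small (F x)"
  shows "small (\<Union>x\<in>A. F x)"
proof -
  obtain b where b: "(\<lambda>x. vset (F x)) ` A = elts b"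
    using small_image[OF assms(1)] by (rule smallE)
  have "(\<Union>x\<in>A. F x) = (\<Union>y\<in>(\<lambda>x. vset (F x)) ` A. elts y)"
    using assms(2) by (simp add: elts_vset)
  then show ?thesis
    unfolding b by (simp only: small_def elts_union)
qed

lemma small_empty: "small {}"
  unfolding small_def by (rule elts_separation) simp

lemma small_doubleton: "small {x, y :: 'v::set_universe}"
proof -
  let ?e = "vset {} :: 'v"
  let ?p = "vset {a. elts a \<subseteq> {}} :: 'v"
  have e: "elts ?e = {}" by (rule elts_vset) (rule small_empty)
  have p: "elts ?p = {a. elts a \<subseteq> {}}"
    by (rule elts_vset) (rule small_Pow[OF small_empty])
  have "?e \<in> elts ?p" unfolding p by (simp add: e)
  then have ne: "?p \<noteq> ?e" using e by force
  have "small {?e, ?p}"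
    by (rule small_subset[OF small_Pow[OF small_elts[of ?p]]]) (simp add: e)
  then have "small ((\<lambda>a. if a = ?e then x else y) ` {?e, ?p})" by (rule small_image)
  then show ?thesis using ne by simp
qed

lemma small_singleton: "small {x}"
  using small_doubleton[of x x] by simp

lemma vset_inject: "small A \<Longrightarrow> small B \<Longrightarrow> vset A = vset B \<longleftrightarrow> A = B"
  by (auto elim!: smallE simp: vset_elts)

lemma vpair_inject [simp]: "vpair x y = vpair x' y' \<longleftrightarrow> x = x' \<and> y = y'"
  by (simp add: vpair_def vset_inject small_doubleton small_singleton doubleton_eq_iff) auto

lemma fam_cod_fam [simp]: "fam_cod (fam A s \<sigma>) = s"
  by (simp add: fam_cod_def fam_def)

lemma fam_at_fam:
  assumes "small A" and "x \<in> A"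
  shows "fam_at (fam A s \<sigma>) x = \<sigma> x"
proof -
  have "elts (vset ((\<lambda>x. vpair x (\<sigma> x)) ` A)) = (\<lambda>x. vpair x (\<sigma> x)) ` A"
    by (rule elts_vset) (rule small_image[OF assms(1)])
  with assms(2) show ?thesis
    by (auto simp: fam_at_def fam_def)
qed


section \<open>Quantaloids\<close>

record ('o, 'a) quantaloid =
  Obj :: "'o set"
  Arr :: "'a set"
  Dom :: "'a \<Rightarrow> 'o"
  Cod :: "'a \<Rightarrow> 'o"
  Id :: "'o \<Rightarrow> 'a"
  Comp :: "'a \<Rightarrow> 'a \<Rightarrow> 'a"  (infixl "\<cdot>\<index>" 70)
  Le :: "'a \<Rightarrow> 'a \<Rightarrow> bool"

definition Hom :: "('o, 'a) quantaloid \<Rightarrow> 'o \<Rightarrow> 'o \<Rightarrow> 'a set" where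
  "Hom Q a b = {u \<in> Arr Q. Dom Q u = a \<and> Cod Q u = b}"

definition hom_lattice :: "('o, 'a) quantaloid \<Rightarrow> 'o \<Rightarrow> 'o \<Rightarrow> 'a gorder" where
  "hom_lattice Q a b = \<lparr>carrier = Hom Q a b, eq = (=), le = Le Q\<rparr>"

definition Sup_hom :: "('o, 'a) quantaloid \<Rightarrow> 'o \<Rightarrow> 'o \<Rightarrow> 'a set \<Rightarrow> 'a" where
  "Sup_hom Q a b S = \<Squnion>\<^bsub>hom_lattice Q a b\<^esub> S"

definition bot_hom :: "('o, 'a) quantaloid \<Rightarrow> 'o \<Rightarrow> 'o \<Rightarrow> 'a" where
  "bot_hom Q a b = \<bottom>\<^bsub>hom_lattice Q a b\<^esub>"

text \<open>Composition is in applicative order: \<open>v \<cdot> u\<close> is \<open>v\<close> after \<open>u\<close>.\<close>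

locale quantaloid =
  fixes Q :: "('o, 'a) quantaloid" (structure)
  assumes Dom_closed: "u \<in> Arr Q \<Longrightarrow> Dom Q u \<in> Obj Q"
    and Cod_closed: "u \<in> Arr Q \<Longrightarrow> Cod Q u \<in> Obj Q"
    and Id_closed: "a \<in> Obj Q \<Longrightarrow> Id Q a \<in> Hom Q a a"
    and Comp_closed: "u \<in> Hom Q a b \<Longrightarrow> v \<in> Hom Q b c \<Longrightarrow> v \<cdot> u \<in> Hom Q a c"
    and Comp_assoc: "u \<in> Hom Q a b \<Longrightarrow> v \<in> Hom Q b c \<Longrightarrow> w \<in> Hom Q c d \<Longrightarrow>
        (w \<cdot> v) \<cdot> u = w \<cdot> (v \<cdot> u)"
    and Id_left: "u \<in> Hom Q a b \<Longrightarrow> Id Q b \<cdot> u = u"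
    and Id_right: "u \<in> Hom Q a b \<Longrightarrow> u \<cdot> Id Q a = u"
    and hom_complete: "a \<in> Obj Q \<Longrightarrow> b \<in> Obj Q \<Longrightarrow> complete_lattice (hom_lattice Q a b)"
    and Comp_Sup_right: "a \<in> Obj Q \<Longrightarrow> S \<subseteq> Hom Q a b \<Longrightarrow> v \<in> Hom Q b c \<Longrightarrow>
        v \<cdot> Sup_hom Q a b S = Sup_hom Q a c ((\<lambda>u. v \<cdot> u) ` S)"
    and Comp_Sup_left: "c \<in> Obj Q \<Longrightarrow> S \<subseteq> Hom Q b c \<Longrightarrow> u \<in> Hom Q a b \<Longrightarrow>
        Sup_hom Q b c S \<cdot> u = Sup_hom Q a c ((\<lambda>v. v \<cdot> u) ` S)"

locale small_quantaloid = quantaloid Q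
  for Q :: "('v::set_universe, 'v) quantaloid" (structure) +
  assumes small_Obj: "small (Obj Q)"
    and small_Arr: "small (Arr Q)"


section \<open>The slice category of sets over the objects of a quantaloid, and monads on it\<close>

text \<open>
  Functions are extensional (\<open>undefined\<close> off their domain), so that equality of HOL functions is
  equality of the mathematical maps, relations and families; composition of maps is
  \<open>compose\<close> from FuncSet.
\<close>

record 'v slice =
  pts :: "'v set"
  ar :: "'v \<Rightarrow> 'v"

definition slices :: "('v::set_universe, 'v) quantaloid \<Rightarrow> 'v slice set" where
  "slices Q = {X. small (pts X) \<and> ar X \<in> pts X \<rightarrow>\<^sub>E Obj Q}"

definition smaps :: "'v slice \<Rightarrow> 'v slice \<Rightarrow> ('v \<Rightarrow> 'v) set" where
  "smaps X Y = {f \<in> pts X \<rightarrow>\<^sub>E pts Y. \<forall>x\<in>pts X. ar Y (f x) = ar X x}"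

definition sid :: "'v slice \<Rightarrow> 'v \<Rightarrow> 'v" where
  "sid X = (\<lambda>x\<in>pts X. x)"

abbreviation slcomp :: "'v slice \<Rightarrow> ('v \<Rightarrow> 'v) \<Rightarrow> ('v \<Rightarrow> 'v) \<Rightarrow> 'v \<Rightarrow> 'v" where
  "slcomp X g f \<equiv> compose (pts X) g f"

text \<open>
  The underlying HOL function of a morphism does not determine its domain and codomain as objects
  of the slice category, so the arrow part of the functor takes them as arguments.
\<close>

record 'v slice_monad =
  Tob :: "'v slice \<Rightarrow> 'v slice"
  Tmap :: "'v slice \<Rightarrow> 'v slice \<Rightarrow> ('v \<Rightarrow> 'v) \<Rightarrow> 'v \<Rightarrow> 'v"
  Tunit :: "'v slice \<Rightarrow> 'v \<Rightarrow> 'v"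
  Tmult :: "'v slice \<Rightarrow> 'v \<Rightarrow> 'v"

locale slice_monad =
  fixes Q :: "('v::set_universe, 'v) quantaloid" and T :: "'v slice_monad"
  assumes Tob_closed: "X \<in> slices Q \<Longrightarrow> Tob T X \<in> slices Q"
    and Tmap_closed: "X \<in> slices Q \<Longrightarrow> Y \<in> slices Q \<Longrightarrow> f \<in> smaps X Y \<Longrightarrow>
        Tmap T X Y f \<in> smaps (Tob T X) (Tob T Y)"
    and Tmap_id: "X \<in> slices Q \<Longrightarrow> Tmap T X X (sid X) = sid (Tob T X)"
    and Tmap_comp: "X \<in> slices Q \<Longrightarrow> Y \<in> slices Q \<Longrightarrow> Z \<in> slices Q \<Longrightarrow>
        f \<in> smaps X Y \<Longrightarrow> g \<in> smaps Y Z \<Longrightarrow>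
        Tmap T X Z (slcomp X g f) = slcomp (Tob T X) (Tmap T Y Z g) (Tmap T X Y f)"
    and Tunit_closed: "X \<in> slices Q \<Longrightarrow> Tunit T X \<in> smaps X (Tob T X)"
    and Tunit_natural: "X \<in> slices Q \<Longrightarrow> Y \<in> slices Q \<Longrightarrow> f \<in> smaps X Y \<Longrightarrow>
        slcomp X (Tmap T X Y f) (Tunit T X) = slcomp X (Tunit T Y) f"
    and Tmult_closed: "X \<in> slices Q \<Longrightarrow> Tmult T X \<in> smaps (Tob T (Tob T X)) (Tob T X)"
    and Tmult_natural: "X \<in> slices Q \<Longrightarrow> Y \<in> slices Q \<Longrightarrow> f \<in> smaps X Y \<Longrightarrow>
        slcomp (Tob T (Tob T X)) (Tmap T X Y f) (Tmult T X) =
        slcomp (Tob T (Tob T X)) (Tmult T Y) (Tmap T (Tob T X) (Tob T Y) (Tmap T X Y f))"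
    and unit_left: "X \<in> slices Q \<Longrightarrow>
        slcomp (Tob T X) (Tmult T X) (Tunit T (Tob T X)) = sid (Tob T X)"
    and unit_right: "X \<in> slices Q \<Longrightarrow>
        slcomp (Tob T X) (Tmult T X) (Tmap T X (Tob T X) (Tunit T X)) = sid (Tob T X)"
    and mult_assoc: "X \<in> slices Q \<Longrightarrow>
        slcomp (Tob T (Tob T (Tob T X))) (Tmult T X) (Tmult T (Tob T X)) =
        slcomp (Tob T (Tob T (Tob T X))) (Tmult T X)
          (Tmap T (Tob T (Tob T X)) (Tob T X) (Tmult T X))"


section \<open>Relations valued in a quantaloid\<close>

definition Rel :: "('v, 'v) quantaloid \<Rightarrow> 'v slice \<Rightarrow> 'v slice \<Rightarrow> ('v \<Rightarrow> 'v \<Rightarrow> 'v) set" where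
  "Rel Q X Y = (\<Pi>\<^sub>E x\<in>pts X. \<Pi>\<^sub>E y\<in>pts Y. Hom Q (ar X x) (ar Y y))"

definition rel_le :: "('v, 'v) quantaloid \<Rightarrow> 'v slice \<Rightarrow> 'v slice \<Rightarrow>
    ('v \<Rightarrow> 'v \<Rightarrow> 'v) \<Rightarrow> ('v \<Rightarrow> 'v \<Rightarrow> 'v) \<Rightarrow> bool" where
  "rel_le Q X Y \<phi> \<phi>' \<longleftrightarrow> (\<forall>x\<in>pts X. \<forall>y\<in>pts Y. Le Q (\<phi> x y) (\<phi>' x y))"

text \<open>The composite of \<open>\<phi>\<close> from \<open>X\<close> to \<open>Y\<close> followed by \<open>\<psi>\<close> from \<open>Y\<close> to \<open>Z\<close>.\<close>

definition rcomp :: "('v, 'v) quantaloid \<Rightarrow> 'v slice \<Rightarrow> 'v slice \<Rightarrow> 'v slice \<Rightarrow>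
    ('v \<Rightarrow> 'v \<Rightarrow> 'v) \<Rightarrow> ('v \<Rightarrow> 'v \<Rightarrow> 'v) \<Rightarrow> 'v \<Rightarrow> 'v \<Rightarrow> 'v" where
  "rcomp Q X Y Z \<psi> \<phi> = (\<lambda>x\<in>pts X. \<lambda>z\<in>pts Z.
     Sup_hom Q (ar X x) (ar Z z) ((\<lambda>y. Comp Q (\<psi> y z) (\<phi> x y)) ` pts Y))"

text \<open>
  For \<open>f\<close> from \<open>X\<close> to \<open>Y\<close>, \<open>lower_star\<close> is a relation from \<open>X\<close> to \<open>Y\<close> and \<open>upper_star\<close> one from
  \<open>Y\<close> to \<open>X\<close>; both take the object arguments in the order \<open>X\<close>, \<open>Y\<close>.
\<close>

definition lower_star :: "('v, 'v) quantaloid \<Rightarrow> 'v slice \<Rightarrow> 'v slice \<Rightarrow>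
    ('v \<Rightarrow> 'v) \<Rightarrow> 'v \<Rightarrow> 'v \<Rightarrow> 'v" where
  "lower_star Q X Y f = (\<lambda>x\<in>pts X. \<lambda>y\<in>pts Y.
     if f x = y then Id Q (ar X x) else bot_hom Q (ar X x) (ar Y y))"

definition upper_star :: "('v, 'v) quantaloid \<Rightarrow> 'v slice \<Rightarrow> 'v slice \<Rightarrow>
    ('v \<Rightarrow> 'v) \<Rightarrow> 'v \<Rightarrow> 'v \<Rightarrow> 'v" where
  "upper_star Q X Y f = (\<lambda>y\<in>pts Y. \<lambda>x\<in>pts X.
     if f x = y then Id Q (ar X x) else bot_hom Q (ar Y y) (ar X x))"


section \<open>The discrete presheaf monad\<close>

definition Pob :: "('v::set_universe, 'v) quantaloid \<Rightarrow> 'v slice \<Rightarrow> 'v slice" where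
  "Pob Q X = (let F = {fam (pts X) s \<sigma> |s \<sigma>. s \<in> Obj Q \<and> (\<forall>x\<in>pts X. \<sigma> x \<in> Hom Q (ar X x) s)}
     in \<lparr>pts = F, ar = restrict fam_cod F\<rparr>)"

definition P_le :: "('v::set_universe, 'v) quantaloid \<Rightarrow> 'v slice \<Rightarrow> 'v \<Rightarrow> 'v \<Rightarrow> bool" where
  "P_le Q X p p' \<longleftrightarrow> fam_cod p = fam_cod p' \<and> (\<forall>x\<in>pts X. Le Q (fam_at p x) (fam_at p' x))"

text \<open>The pointwise order on maps from \<open>Y\<close> into the presheaves on \<open>X\<close>.\<close>

definition Pmap_le :: "('v::set_universe, 'v) quantaloid \<Rightarrow> 'v slice \<Rightarrow> 'v slice \<Rightarrow>
    ('v \<Rightarrow> 'v) \<Rightarrow> ('v \<Rightarrow> 'v) \<Rightarrow> bool" where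
  "Pmap_le Q Y X f g \<longleftrightarrow> (\<forall>y\<in>pts Y. P_le Q X (f y) (g y))"

definition Pmap :: "('v::set_universe, 'v) quantaloid \<Rightarrow> 'v slice \<Rightarrow> 'v slice \<Rightarrow>
    ('v \<Rightarrow> 'v) \<Rightarrow> 'v \<Rightarrow> 'v" where
  "Pmap Q X Y f = (\<lambda>p\<in>pts (Pob Q X). fam (pts Y) (fam_cod p)
     (\<lambda>y. Sup_hom Q (ar Y y) (fam_cod p) (fam_at p ` {x \<in> pts X. f x = y})))"

definition Punit :: "('v::set_universe, 'v) quantaloid \<Rightarrow> 'v slice \<Rightarrow> 'v \<Rightarrow> 'v" where
  "Punit Q X = (\<lambda>y\<in>pts X. fam (pts X) (ar X y)
     (\<lambda>x. if x = y then Id Q (ar X y) else bot_hom Q (ar X x) (ar X y)))"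

definition Pmult :: "('v::set_universe, 'v) quantaloid \<Rightarrow> 'v slice \<Rightarrow> 'v \<Rightarrow> 'v" where
  "Pmult Q X = (\<lambda>S\<in>pts (Pob Q (Pob Q X)). fam (pts X) (fam_cod S)
     (\<lambda>x. Sup_hom Q (ar X x) (fam_cod S)
       ((\<lambda>p. Comp Q (fam_at S p) (fam_at p x)) ` pts (Pob Q X))))"

definition larrow :: "'v::set_universe slice \<Rightarrow> 'v slice \<Rightarrow>
    ('v \<Rightarrow> 'v \<Rightarrow> 'v) \<Rightarrow> 'v \<Rightarrow> 'v" where
  "larrow X Y \<phi> = (\<lambda>y\<in>pts Y. fam (pts X) (ar Y y) (\<lambda>x. \<phi> x y))"

definition eps :: "('v::set_universe, 'v) quantaloid \<Rightarrow> 'v slice \<Rightarrow> 'v \<Rightarrow> 'v \<Rightarrow> 'v" where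
  "eps Q X = (\<lambda>x\<in>pts X. \<lambda>p\<in>pts (Pob Q X). fam_at p x)"


section \<open>Monotone distributive laws\<close>

definition monotone_distributive_laws ::
    "('v::set_universe, 'v) quantaloid \<Rightarrow> 'v slice_monad \<Rightarrow> ('v slice \<Rightarrow> 'v \<Rightarrow> 'v) set" where
  "monotone_distributive_laws Q T =
    {l \<in> (\<Pi>\<^sub>E X\<in>slices Q. smaps (Tob T (Pob Q X)) (Pob Q (Tob T X))).
      (\<forall>X\<in>slices Q. \<forall>Y\<in>slices Q. \<forall>f\<in>smaps X Y.
         Pmap_le Q (Tob T (Pob Q X)) (Tob T Y)
           (slcomp (Tob T (Pob Q X)) (Pmap Q (Tob T X) (Tob T Y) (Tmap T X Y f)) (l X))
           (slcomp (Tob T (Pob Q X)) (l Y) (Tmap T (Pob Q X) (Pob Q Y) (Pmap Q X Y f)))) \<and>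
      (\<forall>X\<in>slices Q.
         Pmap_le Q (Tob T X) (Tob T X)
           (Punit Q (Tob T X))
           (slcomp (Tob T X) (l X) (Tmap T X (Pob Q X) (Punit Q X)))) \<and>
      (\<forall>X\<in>slices Q.
         Pmap_le Q (Tob T (Pob Q (Pob Q X))) (Tob T X)
           (slcomp (Tob T (Pob Q (Pob Q X))) (Pmult Q (Tob T X))
             (slcomp (Tob T (Pob Q (Pob Q X)))
               (Pmap Q (Tob T (Pob Q X)) (Pob Q (Tob T X)) (l X)) (l (Pob Q X))))
           (slcomp (Tob T (Pob Q (Pob Q X))) (l X)
             (Tmap T (Pob Q (Pob Q X)) (Pob Q X) (Pmult Q X)))) \<and>
      (\<forall>X\<in>slices Q.
         Pmap_le Q (Pob Q X) (Tob T X)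
           (Pmap Q X (Tob T X) (Tunit T X))
           (slcomp (Pob Q X) (l X) (Tunit T (Pob Q X)))) \<and>
      (\<forall>X\<in>slices Q.
         Pmap_le Q (Tob T (Tob T (Pob Q X))) (Tob T X)
           (slcomp (Tob T (Tob T (Pob Q X))) (Pmap Q (Tob T (Tob T X)) (Tob T X) (Tmult T X))
             (slcomp (Tob T (Tob T (Pob Q X))) (l (Tob T X))
               (Tmap T (Tob T (Pob Q X)) (Pob Q (Tob T X)) (l X))))
           (slcomp (Tob T (Tob T (Pob Q X))) (l X) (Tmult T (Pob Q X)))) \<and>
      (\<forall>X\<in>slices Q. \<forall>Y\<in>slices Q. \<forall>f\<in>smaps Y (Pob Q X). \<forall>g\<in>smaps Y (Pob Q X).
         Pmap_le Q Y X f g \<longrightarrow>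
         Pmap_le Q (Tob T Y) (Tob T X)
           (slcomp (Tob T Y) (l X) (Tmap T Y (Pob Q X) f))
           (slcomp (Tob T Y) (l X) (Tmap T Y (Pob Q X) g)))}"


section \<open>Extension families and lax extensions\<close>

type_synonym 'v family = "'v slice \<Rightarrow> 'v slice \<Rightarrow> ('v \<Rightarrow> 'v \<Rightarrow> 'v) \<Rightarrow> 'v \<Rightarrow> 'v \<Rightarrow> 'v"

definition extension_families ::
    "('v::set_universe, 'v) quantaloid \<Rightarrow> 'v slice_monad \<Rightarrow> 'v family set" where
  "extension_families Q T =
    (\<Pi>\<^sub>E X\<in>slices Q. \<Pi>\<^sub>E Y\<in>slices Q. \<Pi>\<^sub>E \<phi>\<in>Rel Q X Y. Rel Q (Tob T X) (Tob T Y))"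

definition monotone_extension_families ::
    "('v::set_universe, 'v) quantaloid \<Rightarrow> 'v slice_monad \<Rightarrow> 'v family set" where
  "monotone_extension_families Q T =
    {E \<in> extension_families Q T.
      \<forall>X\<in>slices Q. \<forall>Y\<in>slices Q. \<forall>\<phi>\<in>Rel Q X Y. \<forall>\<phi>'\<in>Rel Q X Y.
        rel_le Q X Y \<phi> \<phi>' \<longrightarrow> rel_le Q (Tob T X) (Tob T Y) (E X Y \<phi>) (E X Y \<phi>')}"

definition lax_extensions ::
    "('v::set_universe, 'v) quantaloid \<Rightarrow> 'v slice_monad \<Rightarrow> 'v family set" where
  "lax_extensions Q T =
    {E \<in> monotone_extension_families Q T.
      (\<forall>X\<in>slices Q. \<forall>Y\<in>slices Q. \<forall>Z\<in>slices Q. \<forall>\<phi>\<in>Rel Q X Y. \<forall>h\<in>smaps Z Y.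
         E X Z (rcomp Q X Y Z (upper_star Q Z Y h) \<phi>) =
         rcomp Q (Tob T X) (Tob T Y) (Tob T Z)
           (upper_star Q (Tob T Z) (Tob T Y) (Tmap T Z Y h)) (E X Y \<phi>)) \<and>
      (\<forall>X\<in>slices Q.
         rel_le Q (Tob T X) (Tob T X)
           (upper_star Q (Tob T X) (Tob T X) (sid (Tob T X)))
           (E X X (upper_star Q X X (sid X)))) \<and>
      (\<forall>X\<in>slices Q. \<forall>Y\<in>slices Q. \<forall>Z\<in>slices Q. \<forall>\<phi>\<in>Rel Q X Y. \<forall>\<psi>\<in>Rel Q Y Z.
         rel_le Q (Tob T X) (Tob T Z)
           (rcomp Q (Tob T X) (Tob T Y) (Tob T Z) (E Y Z \<psi>) (E X Y \<phi>))
           (E X Z (rcomp Q X Y Z \<psi> \<phi>))) \<and>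
      (\<forall>X\<in>slices Q. \<forall>Y\<in>slices Q. \<forall>\<phi>\<in>Rel Q X Y.
         rel_le Q (Tob T X) Y
           (rcomp Q (Tob T X) X Y \<phi> (upper_star Q X (Tob T X) (Tunit T X)))
           (rcomp Q (Tob T X) (Tob T Y) Y (upper_star Q Y (Tob T Y) (Tunit T Y)) (E X Y \<phi>))) \<and>
      (\<forall>X\<in>slices Q. \<forall>Y\<in>slices Q. \<forall>\<phi>\<in>Rel Q X Y.
         rel_le Q (Tob T X) (Tob T (Tob T Y))
           (rcomp Q (Tob T X) (Tob T (Tob T X)) (Tob T (Tob T Y))
             (E (Tob T X) (Tob T Y) (E X Y \<phi>))
             (upper_star Q (Tob T (Tob T X)) (Tob T X) (Tmult T X)))
           (rcomp Q (Tob T X) (Tob T Y) (Tob T (Tob T Y))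
             (upper_star Q (Tob T (Tob T Y)) (Tob T Y) (Tmult T Y)) (E X Y \<phi>)))}"


section \<open>The two constructions\<close>

text \<open>
  \<open>ext_of_law\<close> sends a law \<open>l\<close> to the family whose value at \<open>\<phi>\<close> is the relation corresponding
  under \<open>larrow\<close> to the composite of \<open>l\<close> with \<open>T\<close> of \<open>larrow \<phi>\<close>.
\<close>

definition ext_of_law :: "('v::set_universe, 'v) quantaloid \<Rightarrow> 'v slice_monad \<Rightarrow>
    ('v slice \<Rightarrow> 'v \<Rightarrow> 'v) \<Rightarrow> 'v family" where
  "ext_of_law Q T l = (\<lambda>X\<in>slices Q. \<lambda>Y\<in>slices Q. \<lambda>\<phi>\<in>Rel Q X Y.
     the_inv_into (Rel Q (Tob T X) (Tob T Y)) (larrow (Tob T X) (Tob T Y))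
       (slcomp (Tob T Y) (l X) (Tmap T Y (Pob Q X) (larrow X Y \<phi>))))"

definition law_of_ext :: "('v::set_universe, 'v) quantaloid \<Rightarrow> 'v slice_monad \<Rightarrow>
    'v family \<Rightarrow> 'v slice \<Rightarrow> 'v \<Rightarrow> 'v" where
  "law_of_ext Q T E = (\<lambda>X\<in>slices Q.
     larrow (Tob T X) (Tob T (Pob Q X)) (E X (Pob Q X) (eps Q X)))"

end

theory Submission
  imports Defs
begin

text \<open>
  Transposition (\<open>larrow\<close>, with inverse \<open>rarrow\<close>) identifies relations from \<open>X\<close> to \<open>Y\<close> with maps from
  \<open>Y\<close> into the presheaves on \<open>X\<close>, and the evaluation relation \<open>eps\<close> is the transpose of an identity map.
  A relation composed with \<open>upper_star h\<close> is its restriction along \<open>h\<close>, so every relation \<open>\<phi>\<close> is the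
  restriction of \<open>eps\<close> along \<open>larrow \<phi>\<close> (\<open>restriction_eps_larrow\<close>). Consequently a family of relations
  that commutes with restriction is determined by its values at the evaluation relations, and these
  may be any family of maps from \<open>T P X\<close> to \<open>P T X\<close>. This already is the bijection, at the level of
  bare families (\<open>ext_of_law_commutes\<close>, \<open>law_of_ext_ext_of_law\<close>, \<open>ext_of_law_law_of_ext\<close>).

  It remains to see that the axioms correspond. After all suprema are resolved into inequalities
  between single components, four of the axioms of a law correspond to one axiom of an extension
  each. Monotonicity and the axiom for the unit of the presheaf monad translate directly, the latter
  because the transpose of an identity relation is that unit. For the unit and the multiplication of
  \<open>T\<close>, the axiom for the law is the axiom for the extension at \<open>eps\<close>, and naturality carries it from
  there to every relation. The two remaining axioms, lax naturality and lax compatibility with the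
  multiplication of the presheaf monad, correspond jointly, given the others, to lax functoriality of
  the extension. For a composite of \<open>\<phi>\<close> and \<open>\<psi>\<close>, naturality at \<open>larrow \<phi>\<close> moves the two factors to a
  common place, and the multiplication composes them there, because relational composition is
  composition in the Kleisli category of the presheaf monad (\<open>lax_composition_ext_of_law\<close>).
  Conversely, each of the two follows from lax functoriality applied to a composite of an evaluation
  relation with a star or with another evaluation relation (\<open>law_natural_if_lax_extension\<close>,
  \<open>law_Pmult_if_lax_extension\<close>).

  The second description of lax extensions rests on the adjunction between \<open>lower_star f\<close> and
  \<open>upper_star f\<close>. A monotone, laxly functorial family that preserves both stars laxly satisfies both
  inequalities of commutation with restriction, one for each star
  (\<open>commutes_with_restriction_if_preserves_stars\<close>); and a monotone family that commutes with
  restriction and satisfies the inequality for identities preserves both stars laxly.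
\<close>


section \<open>The order on the hom-lattices\<close>

context quantaloid
begin

lemma Hom_objects:
  assumes "u \<in> Hom Q a b"
  shows "a \<in> Obj Q" and "b \<in> Obj Q"
  using assms Dom_closed Cod_closed by (auto simp: Hom_def)

lemma hom_lattice_complete: "u \<in> Hom Q a b \<Longrightarrow> complete_lattice (hom_lattice Q a b)"
  by (rule hom_complete) (auto dest: Hom_objects)

lemma carrier_hom_lattice [simp]: "carrier (hom_lattice Q a b) = Hom Q a b"
  by (simp add: hom_lattice_def)

lemma le_hom_lattice [simp]: "le (hom_lattice Q a b) = Le Q"
  by (simp add: hom_lattice_def)

lemma Le_refl: "u \<in> Hom Q a b \<Longrightarrow> Le Q u u"
  using complete_lattice.axioms(1)[OF hom_lattice_complete, THEN partial_order.axioms(1)]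
  by (metis weak_partial_order.le_refl carrier_hom_lattice le_hom_lattice)

lemma Le_trans:
  assumes "Le Q u v" and "Le Q v w" and "u \<in> Hom Q a b" and "v \<in> Hom Q a b" and "w \<in> Hom Q a b"
  shows "Le Q u w"
  using complete_lattice.axioms(1)[OF hom_lattice_complete, THEN partial_order.axioms(1)] assms
  by (metis weak_partial_order.le_trans carrier_hom_lattice le_hom_lattice)

lemma Le_antisym:
  assumes "Le Q u v" and "Le Q v u" and "u \<in> Hom Q a b" and "v \<in> Hom Q a b"
  shows "u = v"
  using complete_lattice.axioms(1)[OF hom_lattice_complete] assms
  by (metis partial_order.le_antisym carrier_hom_lattice le_hom_lattice)

lemma Sup_hom_closed:
  assumes "a \<in> Obj Q" and "b \<in> Obj Q" and "S \<subseteq> Hom Q a b"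
  shows "Sup_hom Q a b S \<in> Hom Q a b"
proof -
  interpret L: complete_lattice "hom_lattice Q a b" using assms by (intro hom_complete)
  show ?thesis using L.sup_closed[of S] assms by (simp add: Sup_hom_def)
qed

lemma Sup_hom_upper:
  assumes "S \<subseteq> Hom Q a b" and "u \<in> S"
  shows "Le Q u (Sup_hom Q a b S)"
proof -
  have "u \<in> Hom Q a b" using assms by auto
  then interpret L: complete_lattice "hom_lattice Q a b" by (rule hom_lattice_complete)
  show ?thesis using L.sup_upper[of S u] assms by (simp add: Sup_hom_def)
qed

lemma Sup_hom_least:
  assumes "S \<subseteq> Hom Q a b" and "v \<in> Hom Q a b" and "\<And>u. u \<in> S \<Longrightarrow> Le Q u v"
  shows "Le Q (Sup_hom Q a b S) v"
proof -
  interpret L: complete_lattice "hom_lattice Q a b" using assms(2) by (rule hom_lattice_complete)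
  show ?thesis using L.sup_least[of S v] assms by (simp add: Sup_hom_def)
qed

lemma Sup_hom_le_iff:
  assumes "S \<subseteq> Hom Q a b" and "v \<in> Hom Q a b"
  shows "Le Q (Sup_hom Q a b S) v \<longleftrightarrow> (\<forall>u\<in>S. Le Q u v)"
proof
  assume *: "Le Q (Sup_hom Q a b S) v"
  show "\<forall>u\<in>S. Le Q u v"
  proof
    fix u assume "u \<in> S"
    then show "Le Q u v"
      using Le_trans[OF Sup_hom_upper[OF assms(1)] *] Sup_hom_closed assms Hom_objects[OF assms(2)]
      by blast
  qed
qed (use assms in \<open>auto intro: Sup_hom_least\<close>)

lemma Sup_hom_eq_greatest:
  assumes "S \<subseteq> Hom Q a b" and "v \<in> S" and "\<And>u. u \<in> S \<Longrightarrow> Le Q u v"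
  shows "Sup_hom Q a b S = v"
proof (rule Le_antisym)
  show v: "v \<in> Hom Q a b" using assms by auto
  show "Sup_hom Q a b S \<in> Hom Q a b" using Sup_hom_closed Hom_objects[OF v] assms by blast
qed (use assms in \<open>auto intro: Sup_hom_least Sup_hom_upper\<close>)

lemma bot_hom_closed:
  assumes "a \<in> Obj Q" and "b \<in> Obj Q"
  shows "bot_hom Q a b \<in> Hom Q a b"
proof -
  interpret L: complete_lattice "hom_lattice Q a b" using assms by (rule hom_complete)
  show ?thesis using L.bottom_closed by (simp add: bot_hom_def)
qed

lemma bot_hom_least:
  assumes "u \<in> Hom Q a b"
  shows "Le Q (bot_hom Q a b) u"
proof -
  interpret L: complete_lattice "hom_lattice Q a b" using assms by (rule hom_lattice_complete)
  show ?thesis using L.bottom_lower[of u] assms by (simp add: bot_hom_def)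
qed

lemma bot_hom_eq_Sup_hom:
  assumes "a \<in> Obj Q" and "b \<in> Obj Q"
  shows "bot_hom Q a b = Sup_hom Q a b {}"
  using assms
  by (intro Le_antisym[of _ _ a b]) (auto intro: bot_hom_closed bot_hom_least Sup_hom_closed Sup_hom_least)

lemma Comp_bot_right:
  assumes "a \<in> Obj Q" and "v \<in> Hom Q b c"
  shows "v \<cdot> bot_hom Q a b = bot_hom Q a c"
  using Comp_Sup_right[of a "{}" b v c] assms Hom_objects[OF assms(2)] by (simp add: bot_hom_eq_Sup_hom)

lemma Comp_bot_left:
  assumes "c \<in> Obj Q" and "u \<in> Hom Q a b"
  shows "bot_hom Q b c \<cdot> u = bot_hom Q a c"
  using Comp_Sup_left[of c "{}" b u a] assms Hom_objects[OF assms(2)] by (simp add: bot_hom_eq_Sup_hom)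

text \<open>
  Monotonicity of composition is preservation of the binary supremum of a comparable pair.
\<close>

lemma Comp_mono_right:
  assumes "Le Q u u'" and "u \<in> Hom Q a b" and "u' \<in> Hom Q a b" and "v \<in> Hom Q b c"
  shows "Le Q (v \<cdot> u) (v \<cdot> u')"
proof -
  have "Sup_hom Q a b {u, u'} = u'"
    using assms by (intro Sup_hom_eq_greatest) (auto intro: Le_refl)
  then have "v \<cdot> u' = Sup_hom Q a c ((\<lambda>u. v \<cdot> u) ` {u, u'})"
    using Comp_Sup_right[of a "{u, u'}" b v c] Hom_objects(1)[OF assms(2)] assms by simp
  then show ?thesis
    using Sup_hom_upper[of "(\<lambda>u. v \<cdot> u) ` {u, u'}" a c "v \<cdot> u"] assms by (simp add: Comp_closed)
qed

lemma Comp_mono_left: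
  assumes "Le Q v v'" and "u \<in> Hom Q a b" and "v \<in> Hom Q b c" and "v' \<in> Hom Q b c"
  shows "Le Q (v \<cdot> u) (v' \<cdot> u)"
proof -
  have "Sup_hom Q b c {v, v'} = v'"
    using assms by (intro Sup_hom_eq_greatest) (auto intro: Le_refl)
  then have "v' \<cdot> u = Sup_hom Q a c ((\<lambda>v. v \<cdot> u) ` {v, v'})"
    using Comp_Sup_left[of c "{v, v'}" b u a] Hom_objects(2)[OF assms(3)] assms by simp
  then show ?thesis
    using Sup_hom_upper[of "(\<lambda>v. v \<cdot> u) ` {v, v'}" a c "v \<cdot> u"] assms by (simp add: Comp_closed)
qed

lemma Le_Comp_left:
  assumes "u \<in> Hom Q a b" and "v \<in> Hom Q b b" and "Le Q (Id Q b) v"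
  shows "Le Q u (v \<cdot> u)"
  using Comp_mono_left[OF assms(3,1) Id_closed assms(2)] Hom_objects[OF assms(1)] Id_left[OF assms(1)] by simp

lemma Le_Comp_right:
  assumes "u \<in> Hom Q a b" and "v \<in> Hom Q a a" and "Le Q (Id Q a) v"
  shows "Le Q u (u \<cdot> v)"
  using Comp_mono_right[OF assms(3) Id_closed assms(2,1)] Hom_objects[OF assms(1)] Id_right[OF assms(1)] by simp

lemma Sup_hom_Comp_le_iff:
  assumes "c \<in> Obj Q" and "S \<subseteq> Hom Q b c" and "u \<in> Hom Q a b" and "w \<in> Hom Q a c"
  shows "Le Q (Sup_hom Q b c S \<cdot> u) w \<longleftrightarrow> (\<forall>v\<in>S. Le Q (v \<cdot> u) w)"
  unfolding Comp_Sup_left[OF assms(1-3)]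
  using assms by (subst Sup_hom_le_iff) (auto intro: Comp_closed)

end


section \<open>Relations and the stars of a map\<close>

lemma RelI:
  assumes "\<And>x y. x \<in> pts X \<Longrightarrow> y \<in> pts Y \<Longrightarrow> \<phi> x y \<in> Hom Q (ar X x) (ar Y y)"
  shows "(\<lambda>x\<in>pts X. \<lambda>y\<in>pts Y. \<phi> x y) \<in> Rel Q X Y"
  using assms by (auto simp: Rel_def)

lemma Rel_at: "\<phi> \<in> Rel Q X Y \<Longrightarrow> x \<in> pts X \<Longrightarrow> y \<in> pts Y \<Longrightarrow> \<phi> x y \<in> Hom Q (ar X x) (ar Y y)"
  by (auto simp: Rel_def PiE_def Pi_def)

lemma Rel_eqI:
  assumes "\<phi> \<in> Rel Q X Y" and "\<psi> \<in> Rel Q X Y"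
    and "\<And>x y. x \<in> pts X \<Longrightarrow> y \<in> pts Y \<Longrightarrow> \<phi> x y = \<psi> x y"
  shows "\<phi> = \<psi>"
proof (rule PiE_ext)
  show "\<phi> \<in> (\<Pi>\<^sub>E x\<in>pts X. \<Pi>\<^sub>E y\<in>pts Y. Hom Q (ar X x) (ar Y y))"
    and "\<psi> \<in> (\<Pi>\<^sub>E x\<in>pts X. \<Pi>\<^sub>E y\<in>pts Y. Hom Q (ar X x) (ar Y y))"
    using assms(1,2) by (simp_all add: Rel_def)
next
  fix x assume x: "x \<in> pts X"
  show "\<phi> x = \<psi> x"
    by (rule PiE_ext[of _ "pts Y" "\<lambda>y. Hom Q (ar X x) (ar Y y)"])
      (use assms x in \<open>auto simp: Rel_def\<close>)
qed

lemma smaps_at: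
  assumes "f \<in> smaps X Y" and "x \<in> pts X"
  shows "f x \<in> pts Y" and "ar Y (f x) = ar X x"
  using assms by (auto simp: smaps_def)

lemma smaps_eqI:
  assumes "f \<in> smaps X Y" and "g \<in> smaps X Y" and "\<And>x. x \<in> pts X \<Longrightarrow> f x = g x"
  shows "f = g"
  using assms by (intro PiE_ext[of f "pts X" "\<lambda>_. pts Y"]) (auto simp: smaps_def)

lemma sid_closed: "sid X \<in> smaps X X"
  by (auto simp: sid_def smaps_def)

lemma slcomp_closed: "f \<in> smaps X Y \<Longrightarrow> g \<in> smaps Y Z \<Longrightarrow> slcomp X g f \<in> smaps X Z"
  unfolding smaps_def compose_def by (simp add: PiE_iff extensional_def)

lemma slices_at: "X \<in> slices Q \<Longrightarrow> x \<in> pts X \<Longrightarrow> ar X x \<in> Obj Q"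
  by (auto simp: slices_def)

lemma slices_small: "X \<in> slices Q \<Longrightarrow> small (pts X)"
  by (simp add: slices_def)

context small_quantaloid
begin

lemma Comp_Rel:
  "\<phi> \<in> Rel Q X Y \<Longrightarrow> \<psi> \<in> Rel Q Y Z \<Longrightarrow> x \<in> pts X \<Longrightarrow> y \<in> pts Y \<Longrightarrow> z \<in> pts Z \<Longrightarrow>
    \<psi> y z \<cdot> \<phi> x y \<in> Hom Q (ar X x) (ar Z z)"
  by (blast intro: Comp_closed Rel_at)

lemma rcomp_closed:
  assumes "X \<in> slices Q" and "Z \<in> slices Q" and "\<phi> \<in> Rel Q X Y" and "\<psi> \<in> Rel Q Y Z"
  shows "rcomp Q X Y Z \<psi> \<phi> \<in> Rel Q X Z"
  unfolding rcomp_def using assms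
  by (intro RelI Sup_hom_closed) (auto intro: slices_at Comp_Rel)

lemma rcomp_le_iff:
  assumes "\<phi> \<in> Rel Q X Y" and "\<psi> \<in> Rel Q Y Z" and "\<chi> \<in> Rel Q X Z"
  shows "rel_le Q X Z (rcomp Q X Y Z \<psi> \<phi>) \<chi> \<longleftrightarrow>
    (\<forall>x\<in>pts X. \<forall>y\<in>pts Y. \<forall>z\<in>pts Z. Le Q (\<psi> y z \<cdot> \<phi> x y) (\<chi> x z))"
proof -
  have "Le Q (rcomp Q X Y Z \<psi> \<phi> x z) (\<chi> x z) \<longleftrightarrow> (\<forall>y\<in>pts Y. Le Q (\<psi> y z \<cdot> \<phi> x y) (\<chi> x z))"
    if "x \<in> pts X" "z \<in> pts Z" for x z
    unfolding rcomp_def using that assms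
    by (simp, subst Sup_hom_le_iff) (auto intro: Comp_Rel Rel_at)
  then show ?thesis unfolding rel_le_def by blast
qed

lemma lower_star_closed:
  assumes "X \<in> slices Q" and "Y \<in> slices Q" and "f \<in> smaps X Y"
  shows "lower_star Q X Y f \<in> Rel Q X Y"
  unfolding lower_star_def using assms
  by (intro RelI) (auto intro!: bot_hom_closed simp: slices_at smaps_at(2) dest: Id_closed[OF slices_at])

lemma upper_star_closed:
  assumes "X \<in> slices Q" and "Y \<in> slices Q" and "f \<in> smaps X Y"
  shows "upper_star Q X Y f \<in> Rel Q Y X"
  unfolding upper_star_def using assms
  by (intro RelI) (auto intro!: bot_hom_closed simp: slices_at smaps_at(2) dest: Id_closed[OF slices_at])

lemma lower_star_le_iff:
  assumes "f \<in> smaps X Y" and "\<chi> \<in> Rel Q X Y"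
  shows "rel_le Q X Y (lower_star Q X Y f) \<chi> \<longleftrightarrow> (\<forall>x\<in>pts X. Le Q (Id Q (ar X x)) (\<chi> x (f x)))"
  using assms by (auto simp: rel_le_def lower_star_def smaps_at intro!: bot_hom_least Rel_at)

lemma upper_star_le_iff:
  assumes "f \<in> smaps X Y" and "\<chi> \<in> Rel Q Y X"
  shows "rel_le Q Y X (upper_star Q X Y f) \<chi> \<longleftrightarrow> (\<forall>x\<in>pts X. Le Q (Id Q (ar X x)) (\<chi> (f x) x))"
  using assms by (auto simp: rel_le_def upper_star_def smaps_at intro!: bot_hom_least Rel_at)

text \<open>
  In the two composites of this kind, with \<open>upper_star\<close> on the left or \<open>lower_star\<close> on the right, all
  terms of the supremum but one are bottom. They are restrictions along a map.
\<close>

lemma rcomp_upper_star_at: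
  assumes "X \<in> slices Q" and "Y \<in> slices Q" and "Z \<in> slices Q"
    and "\<phi> \<in> Rel Q X Y" and "h \<in> smaps Z Y" and "x \<in> pts X" and "z \<in> pts Z"
  shows "rcomp Q X Y Z (upper_star Q Z Y h) \<phi> x z = \<phi> x (h z)"
proof -
  have \<phi>: "\<phi> x y \<in> Hom Q (ar X x) (ar Y y)" if "y \<in> pts Y" for y
    using Rel_at[OF assms(4,6) that] .
  have hz: "h z \<in> pts Y" "ar Y (h z) = ar Z z" using smaps_at[OF assms(5,7)] by auto
  have eq: "upper_star Q Z Y h y z \<cdot> \<phi> x y =
      (if h z = y then \<phi> x y else bot_hom Q (ar X x) (ar Z z))" if "y \<in> pts Y" for y
    using that assms(7) \<phi>[OF that] hz(2) slices_at[OF assms(3,7)]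
    by (auto simp: upper_star_def Id_left intro: Comp_bot_left)
  have "\<phi> x (h z) \<in> Hom Q (ar X x) (ar Z z)"
    using \<phi>[OF hz(1)] hz(2) by simp
  then have "Sup_hom Q (ar X x) (ar Z z) ((\<lambda>y. upper_star Q Z Y h y z \<cdot> \<phi> x y) ` pts Y) = \<phi> x (h z)"
    using hz(1) bot_hom_closed[OF slices_at[OF assms(1,6)] slices_at[OF assms(3,7)]]
    by (intro Sup_hom_eq_greatest) (auto simp: eq image_iff intro: Le_refl bot_hom_least bexI[of _ "h z"])
  then show ?thesis
    using assms(6,7) by (simp add: rcomp_def)
qed

lemma rcomp_lower_star_at:
  assumes "X \<in> slices Q" and "Y \<in> slices Q" and "Z \<in> slices Q"
    and "f \<in> smaps X Y" and "\<psi> \<in> Rel Q Y Z" and "x \<in> pts X" and "z \<in> pts Z"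
  shows "rcomp Q X Y Z \<psi> (lower_star Q X Y f) x z = \<psi> (f x) z"
proof -
  have \<psi>: "\<psi> y z \<in> Hom Q (ar Y y) (ar Z z)" if "y \<in> pts Y" for y
    using Rel_at[OF assms(5) that assms(7)] .
  have fx: "f x \<in> pts Y" "ar Y (f x) = ar X x" using smaps_at[OF assms(4,6)] by auto
  have eq: "\<psi> y z \<cdot> lower_star Q X Y f x y =
      (if f x = y then \<psi> y z else bot_hom Q (ar X x) (ar Z z))" if "y \<in> pts Y" for y
    using that assms(6) \<psi>[OF that] fx(2) slices_at[OF assms(1,6)]
    by (auto simp: lower_star_def Id_right intro: Comp_bot_right)
  have "\<psi> (f x) z \<in> Hom Q (ar X x) (ar Z z)"
    using \<psi>[OF fx(1)] fx(2) by simp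
  then have "Sup_hom Q (ar X x) (ar Z z) ((\<lambda>y. \<psi> y z \<cdot> lower_star Q X Y f x y) ` pts Y) = \<psi> (f x) z"
    using fx(1) bot_hom_closed[OF slices_at[OF assms(1,6)] slices_at[OF assms(3,7)]]
    by (intro Sup_hom_eq_greatest) (auto simp: eq image_iff intro: Le_refl bot_hom_least bexI[of _ "f x"])
  then show ?thesis
    using assms(6,7) by (simp add: rcomp_def)
qed

text \<open>
  The composites with a star on the other side are suprema over the fibres of the map. As the smaller
  side of an inequality they resolve into one inequality for each point of the domain of the map.
\<close>

lemma lower_star_rcomp_le_iff:
  assumes "X \<in> slices Q" and "Y \<in> slices Q" and "Z \<in> slices Q"
    and "f \<in> smaps Y Z" and "\<phi> \<in> Rel Q X Y" and "\<chi> \<in> Rel Q X Z"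
  shows "rel_le Q X Z (rcomp Q X Y Z (lower_star Q Y Z f) \<phi>) \<chi> \<longleftrightarrow>
    (\<forall>x\<in>pts X. \<forall>y\<in>pts Y. Le Q (\<phi> x y) (\<chi> x (f y)))"
proof -
  have eq: "lower_star Q Y Z f y z \<cdot> \<phi> x y =
      (if f y = z then \<phi> x y else bot_hom Q (ar X x) (ar Z z))"
    if "x \<in> pts X" "y \<in> pts Y" "z \<in> pts Z" for x y z
    using that Rel_at[OF assms(5) that(1,2)] smaps_at[OF assms(4) that(2)] slices_at[OF assms(3) that(3)]
    by (auto simp: lower_star_def Id_left intro: Comp_bot_left)
  show ?thesis
    unfolding rcomp_le_iff[OF assms(5) lower_star_closed[OF assms(2-4)] assms(6)]
    using smaps_at(1)[OF assms(4)] by (auto simp: eq intro!: bot_hom_least Rel_at[OF assms(6)])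
qed

lemma rcomp_upper_star_le_iff:
  assumes "X \<in> slices Q" and "Y \<in> slices Q" and "Z \<in> slices Q"
    and "f \<in> smaps X Y" and "\<phi> \<in> Rel Q X Z" and "\<chi> \<in> Rel Q Y Z"
  shows "rel_le Q Y Z (rcomp Q Y X Z \<phi> (upper_star Q X Y f)) \<chi> \<longleftrightarrow>
    (\<forall>x\<in>pts X. \<forall>z\<in>pts Z. Le Q (\<phi> x z) (\<chi> (f x) z))"
proof -
  have eq: "\<phi> x z \<cdot> upper_star Q X Y f y x =
      (if f x = y then \<phi> x z else bot_hom Q (ar Y y) (ar Z z))"
    if "x \<in> pts X" "y \<in> pts Y" "z \<in> pts Z" for x y z
    using that Rel_at[OF assms(5) that(1,3)] smaps_at[OF assms(4) that(1)] slices_at[OF assms(2) that(2)]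
    by (auto simp: upper_star_def Id_right intro: Comp_bot_right)
  show ?thesis
    unfolding rcomp_le_iff[OF upper_star_closed[OF assms(1,2,4)] assms(5,6)]
    using smaps_at(1)[OF assms(4)] by (auto simp: eq intro!: bot_hom_least Rel_at[OF assms(6)])
qed

end

section \<open>Discrete presheaves\<close>

lemma fam_cong: "(\<And>x. x \<in> A \<Longrightarrow> \<sigma> x = \<tau> x) \<Longrightarrow> fam A s \<sigma> = fam A s \<tau>"
  by (simp add: fam_def cong: image_cong)

lemma fam_mem_Pob:
  "s \<in> Obj Q \<Longrightarrow> (\<And>x. x \<in> pts X \<Longrightarrow> \<sigma> x \<in> Hom Q (ar X x) s) \<Longrightarrow> fam (pts X) s \<sigma> \<in> pts (Pob Q X)"
  by (auto simp: Pob_def Let_def)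

lemma Pob_cases:
  assumes "p \<in> pts (Pob Q X)"
  obtains s \<sigma> where "p = fam (pts X) s \<sigma>" and "s \<in> Obj Q"
    and "\<And>x. x \<in> pts X \<Longrightarrow> \<sigma> x \<in> Hom Q (ar X x) s"
  using assms by (auto simp: Pob_def Let_def)

lemma Pob_ar: "p \<in> pts (Pob Q X) \<Longrightarrow> ar (Pob Q X) p = fam_cod p"
  by (auto simp: Pob_def Let_def)

lemma Pob_cod: "p \<in> pts (Pob Q X) \<Longrightarrow> fam_cod p \<in> Obj Q"
  by (erule Pob_cases) simp

lemma Pob_at: "X \<in> slices Q \<Longrightarrow> p \<in> pts (Pob Q X) \<Longrightarrow> x \<in> pts X \<Longrightarrow> fam_at p x \<in> Hom Q (ar X x) (fam_cod p)"
  by (erule Pob_cases) (simp add: fam_at_fam slices_small)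

lemma Pob_at': "X \<in> slices Q \<Longrightarrow> p \<in> pts (Pob Q X) \<Longrightarrow> x \<in> pts X \<Longrightarrow>
    fam_at p x \<in> Hom Q (ar X x) (ar (Pob Q X) p)"
  by (simp add: Pob_at Pob_ar)

lemma fam_Pob:
  assumes "X \<in> slices Q" and "p \<in> pts (Pob Q X)"
  shows "fam (pts X) (fam_cod p) (fam_at p) = p"
  using assms(2) by (rule Pob_cases) (auto intro!: fam_cong simp: fam_at_fam slices_small[OF assms(1)])

lemma Pob_eqI:
  assumes "X \<in> slices Q" and "p \<in> pts (Pob Q X)" and "p' \<in> pts (Pob Q X)"
    and "fam_cod p = fam_cod p'" and "\<And>x. x \<in> pts X \<Longrightarrow> fam_at p x = fam_at p' x"
  shows "p = p'"
proof -
  have "p = fam (pts X) (fam_cod p) (fam_at p)"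
    using fam_Pob[OF assms(1,2)] by simp
  also have "\<dots> = fam (pts X) (fam_cod p') (fam_at p')"
    using assms(4) fam_cong[OF assms(5)] by simp
  also have "\<dots> = p'"
    by (rule fam_Pob[OF assms(1,3)])
  finally show ?thesis .
qed

lemma small_image2:
  fixes f :: "'v::set_universe \<Rightarrow> 'v \<Rightarrow> 'v"
  assumes "small A" and "small B"
  shows "small ((\<lambda>(a, b). f a b) ` (A \<times> B))"
proof -
  have "(\<lambda>(a, b). f a b) ` (A \<times> B) = (\<Union>a\<in>A. f a ` B)" by auto
  then show ?thesis using assms by (simp add: small_UN small_image)
qed

text \<open>
  Smallness: a presheaf is a pair of an object and a set of pairs \<open>(x, u)\<close> with \<open>u\<close> an arrow, and for a
  small quantaloid these pairs range over a small set.
\<close>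

lemma (in small_quantaloid) Pob_closed:
  assumes X: "X \<in> slices Q"
  shows "Pob Q X \<in> slices Q"
proof -
  define G where "G = (\<lambda>(x, u). vpair x u) ` (pts X \<times> Arr Q)"
  have G: "small G"
    unfolding G_def by (intro small_image2 slices_small[OF X] small_Arr)
  have "pts (Pob Q X) \<subseteq> (\<lambda>(s, g). vpair s g) ` (Obj Q \<times> {g. elts g \<subseteq> G})"
  proof
    fix p assume "p \<in> pts (Pob Q X)"
    then obtain s \<sigma> where p: "p = fam (pts X) s \<sigma>" "s \<in> Obj Q"
      and \<sigma>: "\<And>x. x \<in> pts X \<Longrightarrow> \<sigma> x \<in> Hom Q (ar X x) s"
      by (rule Pob_cases) blast
    have "elts (vset ((\<lambda>x. vpair x (\<sigma> x)) ` pts X)) \<subseteq> G"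
      using \<sigma> by (auto simp: G_def Hom_def elts_vset small_image slices_small[OF X])
    then show "p \<in> (\<lambda>(s, g). vpair s g) ` (Obj Q \<times> {g. elts g \<subseteq> G})"
      using p by (auto simp: fam_def)
  qed
  then have "small (pts (Pob Q X))"
    by (rule small_subset[rotated]) (intro small_image2 small_Obj small_Pow G)
  moreover have "ar (Pob Q X) \<in> pts (Pob Q X) \<rightarrow>\<^sub>E Obj Q"
    using Pob_cod[of _ Q X] by (auto simp: Pob_def Let_def)
  ultimately show ?thesis
    by (simp add: slices_def)
qed


subsection \<open>Relations as maps into presheaves\<close>

context small_quantaloid
begin

lemma larrow_at:
  "X \<in> slices Q \<Longrightarrow> x \<in> pts X \<Longrightarrow> y \<in> pts Y \<Longrightarrow> fam_at (larrow X Y \<phi> y) x = \<phi> x y"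
  by (simp add: larrow_def fam_at_fam slices_small)

lemma larrow_cod: "y \<in> pts Y \<Longrightarrow> fam_cod (larrow X Y \<phi> y) = ar Y y"
  by (simp add: larrow_def)

lemma larrow_closed:
  assumes "Y \<in> slices Q" and "\<phi> \<in> Rel Q X Y"
  shows "larrow X Y \<phi> \<in> smaps Y (Pob Q X)"
proof -
  have "larrow X Y \<phi> y \<in> pts (Pob Q X)" if "y \<in> pts Y" for y
    using that assms by (auto simp: larrow_def intro!: fam_mem_Pob slices_at Rel_at)
  then show ?thesis
    by (auto simp: smaps_def Pob_ar larrow_cod) (auto simp: larrow_def)
qed

text \<open>The inverse of \<open>larrow\<close>.\<close>

definition rarrow :: "'v slice \<Rightarrow> 'v slice \<Rightarrow> ('v \<Rightarrow> 'v) \<Rightarrow> 'v \<Rightarrow> 'v \<Rightarrow> 'v" where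
  "rarrow X Y g = (\<lambda>x\<in>pts X. \<lambda>y\<in>pts Y. fam_at (g y) x)"

lemma rarrow_at: "x \<in> pts X \<Longrightarrow> y \<in> pts Y \<Longrightarrow> rarrow X Y g x y = fam_at (g y) x"
  by (simp add: rarrow_def)

lemma rarrow_closed:
  assumes "X \<in> slices Q" and "g \<in> smaps Y (Pob Q X)"
  shows "rarrow X Y g \<in> Rel Q X Y"
  unfolding rarrow_def
proof (rule RelI)
  fix x y assume "x \<in> pts X" and y: "y \<in> pts Y"
  then show "fam_at (g y) x \<in> Hom Q (ar X x) (ar Y y)"
    using Pob_at'[OF assms(1) smaps_at(1)[OF assms(2) y]] smaps_at(2)[OF assms(2) y] by simp
qed

lemma Pob_map_eqI:
  assumes "X \<in> slices Q" and "f \<in> smaps Y (Pob Q X)" and "g \<in> smaps Y (Pob Q X)"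
    and "\<And>x y. x \<in> pts X \<Longrightarrow> y \<in> pts Y \<Longrightarrow> fam_at (f y) x = fam_at (g y) x"
  shows "f = g"
proof (rule smaps_eqI[OF assms(2,3)])
  fix y assume y: "y \<in> pts Y"
  show "f y = g y"
    using smaps_at[OF assms(2) y] smaps_at[OF assms(3) y] y assms(4)
    by (intro Pob_eqI[OF assms(1), of "f y" "g y"]) (auto simp: Pob_ar)
qed

lemma larrow_rarrow:
  assumes "X \<in> slices Q" and "Y \<in> slices Q" and "g \<in> smaps Y (Pob Q X)"
  shows "larrow X Y (rarrow X Y g) = g"
  using assms
  by (intro Pob_map_eqI[where X = X and Y = Y]) (auto simp: larrow_at rarrow_at intro!: larrow_closed rarrow_closed)

lemma rarrow_larrow:
  assumes "X \<in> slices Q" and "Y \<in> slices Q" and "\<phi> \<in> Rel Q X Y"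
  shows "rarrow X Y (larrow X Y \<phi>) = \<phi>"
  using assms
  by (intro Rel_eqI[of _ Q X Y] rarrow_closed larrow_closed) (auto simp: larrow_at rarrow_at)

lemma the_inv_into_larrow:
  assumes "X \<in> slices Q" and "Y \<in> slices Q" and "g \<in> smaps Y (Pob Q X)"
  shows "the_inv_into (Rel Q X Y) (larrow X Y) g = rarrow X Y g"
  by (rule the_inv_into_f_eq)
    (use assms in \<open>auto intro: rarrow_closed larrow_rarrow inj_on_inverseI[where g = "rarrow X Y"] rarrow_larrow\<close>)

text \<open>
  Array-preserving maps have equal arrays at corresponding points, so comparing two of them into
  presheaves amounts to comparing components.
\<close>

lemma Pmap_le_iff:
  assumes "f \<in> smaps Y (Pob Q X)" and "g \<in> smaps Y (Pob Q X)"
  shows "Pmap_le Q Y X f g \<longleftrightarrow> (\<forall>y\<in>pts Y. \<forall>x\<in>pts X. Le Q (fam_at (f y) x) (fam_at (g y) x))"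
proof -
  have "fam_cod (f y) = fam_cod (g y)" if "y \<in> pts Y" for y
    using smaps_at[OF assms(1) that] smaps_at[OF assms(2) that] by (simp add: Pob_ar)
  then show ?thesis by (auto simp: Pmap_le_def P_le_def)
qed

lemma eps_closed: "X \<in> slices Q \<Longrightarrow> eps Q X \<in> Rel Q X (Pob Q X)"
  unfolding eps_def by (intro RelI Pob_at')

lemma eps_at [simp]: "x \<in> pts X \<Longrightarrow> p \<in> pts (Pob Q X) \<Longrightarrow> eps Q X x p = fam_at p x"
  by (simp add: eps_def)

lemma larrow_eps: "X \<in> slices Q \<Longrightarrow> larrow X (Pob Q X) (eps Q X) = sid (Pob Q X)"
  by (rule Pob_map_eqI[where X = X and Y = "Pob Q X"])
    (auto simp: larrow_at sid_closed intro!: larrow_closed Pob_closed eps_closed, simp add: sid_def)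

lemma Punit_eq_larrow: "Punit Q X = larrow X X (upper_star Q X X (sid X))"
  unfolding Punit_def larrow_def
  by (auto intro!: restrict_ext fam_cong simp: upper_star_def sid_def)

lemma Punit_closed: "X \<in> slices Q \<Longrightarrow> Punit Q X \<in> smaps X (Pob Q X)"
  unfolding Punit_eq_larrow by (intro larrow_closed upper_star_closed sid_closed)

lemma Pmap_closed:
  assumes "X \<in> slices Q" and "Y \<in> slices Q" and "f \<in> smaps X Y"
  shows "Pmap Q X Y f \<in> smaps (Pob Q X) (Pob Q Y)"
proof -
  have "fam_at p ` {x \<in> pts X. f x = y} \<subseteq> Hom Q (ar Y y) (fam_cod p)"
    if "p \<in> pts (Pob Q X)" for p y
    using Pob_at[OF assms(1) that] smaps_at[OF assms(3)] by auto
  then have "Pmap Q X Y f p \<in> pts (Pob Q Y)" if "p \<in> pts (Pob Q X)" for p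
    using that assms
    by (auto simp: Pmap_def intro!: fam_mem_Pob Pob_cod Sup_hom_closed slices_at)
  then show ?thesis
    by (auto simp: smaps_def Pob_ar) (auto simp: Pmap_def)
qed

lemma Pmult_closed:
  assumes "X \<in> slices Q"
  shows "Pmult Q X \<in> smaps (Pob Q (Pob Q X)) (Pob Q X)"
proof -
  have "(\<lambda>p. fam_at S p \<cdot> fam_at p x) ` pts (Pob Q X) \<subseteq> Hom Q (ar X x) (fam_cod S)"
    if "S \<in> pts (Pob Q (Pob Q X))" "x \<in> pts X" for S x
    using Comp_closed[OF Pob_at'[OF assms _ that(2)] Pob_at[OF Pob_closed[OF assms] that(1)]] by auto
  then have "Pmult Q X S \<in> pts (Pob Q X)" if "S \<in> pts (Pob Q (Pob Q X))" for S
    using that assms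
    by (auto simp: Pmult_def intro!: fam_mem_Pob Pob_cod Sup_hom_closed slices_at)
  then show ?thesis
    by (auto simp: smaps_def Pob_ar) (auto simp: Pmult_def)
qed

lemma Pmap_at:
  "X \<in> slices Q \<Longrightarrow> Y \<in> slices Q \<Longrightarrow> p \<in> pts (Pob Q X) \<Longrightarrow> y \<in> pts Y \<Longrightarrow>
    fam_at (Pmap Q X Y f p) y = Sup_hom Q (ar Y y) (fam_cod p) (fam_at p ` {x \<in> pts X. f x = y})"
  by (simp add: Pmap_def fam_at_fam slices_small)

lemma Pmult_at:
  "X \<in> slices Q \<Longrightarrow> S \<in> pts (Pob Q (Pob Q X)) \<Longrightarrow> x \<in> pts X \<Longrightarrow>
    fam_at (Pmult Q X S) x =
      Sup_hom Q (ar X x) (fam_cod S) ((\<lambda>p. fam_at S p \<cdot> fam_at p x) ` pts (Pob Q X))"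
  by (simp add: Pmult_def fam_at_fam slices_small)

lemma Pmap_le_at_iff:
  assumes "X \<in> slices Q" and "Y \<in> slices Q" and "f \<in> smaps X Y" and "p \<in> pts (Pob Q X)"
    and "\<And>y. y \<in> pts Y \<Longrightarrow> w y \<in> Hom Q (ar Y y) (fam_cod p)"
  shows "(\<forall>y\<in>pts Y. Le Q (fam_at (Pmap Q X Y f p) y) (w y)) \<longleftrightarrow>
    (\<forall>x\<in>pts X. Le Q (fam_at p x) (w (f x)))"
proof -
  have "fam_at p ` {x \<in> pts X. f x = y} \<subseteq> Hom Q (ar Y y) (fam_cod p)" for y
    using Pob_at[OF assms(1,4)] smaps_at[OF assms(3)] by auto
  then have "Le Q (fam_at (Pmap Q X Y f p) y) (w y) \<longleftrightarrow>
      (\<forall>x\<in>pts X. f x = y \<longrightarrow> Le Q (fam_at p x) (w y))" if "y \<in> pts Y" for y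
    unfolding Pmap_at[OF assms(1,2,4) that] using assms(5)[OF that] by (subst Sup_hom_le_iff) auto
  then show ?thesis
    using smaps_at(1)[OF assms(3)] by auto
qed

lemma Pmult_le_at_iff:
  assumes "X \<in> slices Q" and "S \<in> pts (Pob Q (Pob Q X))" and "x \<in> pts X"
    and "w \<in> Hom Q (ar X x) (fam_cod S)"
  shows "Le Q (fam_at (Pmult Q X S) x) w \<longleftrightarrow>
    (\<forall>p\<in>pts (Pob Q X). Le Q (fam_at S p \<cdot> fam_at p x) w)"
proof -
  have "(\<lambda>p. fam_at S p \<cdot> fam_at p x) ` pts (Pob Q X) \<subseteq> Hom Q (ar X x) (fam_cod S)"
    using Comp_closed[OF Pob_at'[OF assms(1) _ assms(3)] Pob_at[OF Pob_closed[OF assms(1)] assms(2)]] by auto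
  then show ?thesis
    unfolding Pmult_at[OF assms(1-3)] using assms(4) by (subst Sup_hom_le_iff) auto
qed

text \<open>
  Composition in the Kleisli category of the presheaf monad is relational composition: the supremum
  over presheaves \<open>p\<close> of the suprema over the fibres \<open>g y = p\<close> collapses to a supremum over \<open>y\<close>, as
  composition preserves the inner suprema.
\<close>

lemma Pmult_Pmap_le_at_iff:
  assumes "X \<in> slices Q" and "Y \<in> slices Q" and "g \<in> smaps Y (Pob Q X)" and "R \<in> pts (Pob Q Y)"
    and "x \<in> pts X" and "w \<in> Hom Q (ar X x) (fam_cod R)"
  shows "Le Q (fam_at (Pmult Q X (Pmap Q Y (Pob Q X) g R)) x) w \<longleftrightarrow>
    (\<forall>y\<in>pts Y. Le Q (fam_at R y \<cdot> fam_at (g y) x) w)"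
proof -
  let ?P = "Pob Q X"
  have P: "?P \<in> slices Q" using assms(1) by (rule Pob_closed)
  have S: "Pmap Q Y ?P g R \<in> pts (Pob Q ?P)" "fam_cod (Pmap Q Y ?P g R) = fam_cod R"
    using smaps_at[OF Pmap_closed[OF assms(2) P assms(3)] assms(4)] assms(4) by (auto simp: Pob_ar)
  have "Le Q (fam_at (Pmap Q Y ?P g R) p \<cdot> fam_at p x) w \<longleftrightarrow>
      (\<forall>y\<in>pts Y. g y = p \<longrightarrow> Le Q (fam_at R y \<cdot> fam_at p x) w)" if p: "p \<in> pts ?P" for p
  proof -
    have "fam_at R ` {y \<in> pts Y. g y = p} \<subseteq> Hom Q (ar ?P p) (fam_cod R)"
      using Pob_at[OF assms(2,4)] smaps_at[OF assms(3)] by auto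
    then show ?thesis
      unfolding Pmap_at[OF assms(2) P assms(4) p]
      using Pob_cod[OF assms(4)] Pob_at'[OF assms(1) p assms(5)] assms(6)
      by (subst Sup_hom_Comp_le_iff) auto
  qed
  then show ?thesis
    using Pmult_le_at_iff[OF assms(1) S(1) assms(5)] S(2) assms(6) smaps_at(1)[OF assms(3)] by auto
qed

end

section \<open>Extension families and their laxness conditions, pointwise\<close>

locale monad_over_quantaloid = small_quantaloid Q + slice_monad Q T
  for Q :: "('v::set_universe, 'v) quantaloid" (structure) and T :: "'v slice_monad"
begin

abbreviation P :: "'v slice \<Rightarrow> 'v slice" where "P \<equiv> Pob Q"
abbreviation F :: "'v slice \<Rightarrow> 'v slice" where "F \<equiv> Tob T"
abbreviation unit :: "'v slice \<Rightarrow> 'v \<Rightarrow> 'v" where "unit \<equiv> Tunit T"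
abbreviation mult :: "'v slice \<Rightarrow> 'v \<Rightarrow> 'v" where "mult \<equiv> Tmult T"
abbreviation unit_rel :: "'v slice \<Rightarrow> 'v \<Rightarrow> 'v \<Rightarrow> 'v" where "unit_rel X \<equiv> upper_star Q X X (sid X)"

lemma Tmap_comp_at:
  assumes "X \<in> slices Q" and "Y \<in> slices Q" and "Z \<in> slices Q"
    and "f \<in> smaps X Y" and "g \<in> smaps Y Z" and "a \<in> pts (F X)"
  shows "Tmap T X Z (slcomp X g f) a = Tmap T Y Z g (Tmap T X Y f a)"
  using Tmap_comp[OF assms(1-5)] assms(6) by (simp add: compose_eq)

lemma Tmap_id_at: "X \<in> slices Q \<Longrightarrow> a \<in> pts (F X) \<Longrightarrow> Tmap T X X (sid X) a = a"
  by (simp add: Tmap_id sid_def[of "F X"])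

lemma Tunit_natural_at:
  assumes "X \<in> slices Q" and "Y \<in> slices Q" and "f \<in> smaps X Y" and "x \<in> pts X"
  shows "Tmap T X Y f (unit X x) = unit Y (f x)"
  using fun_cong[OF Tunit_natural[OF assms(1-3)], of x] assms(4) by (simp add: compose_eq)

lemma Tmult_natural_at:
  assumes "X \<in> slices Q" and "Y \<in> slices Q" and "f \<in> smaps X Y" and "A \<in> pts (F (F X))"
  shows "Tmap T X Y f (mult X A) = mult Y (Tmap T (F X) (F Y) (Tmap T X Y f) A)"
  using fun_cong[OF Tmult_natural[OF assms(1-3)], of A] assms(4) by (simp add: compose_eq)

lemmas Tmap_at = smaps_at[OF Tmap_closed]
lemmas unit_at = smaps_at[OF Tunit_closed]
lemmas mult_at = smaps_at[OF Tmult_closed]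

lemma extension_families_iff:
  "E \<in> extension_families Q T \<longleftrightarrow> E \<in> extensional (slices Q) \<and>
    (\<forall>X\<in>slices Q. E X \<in> extensional (slices Q) \<and>
      (\<forall>Y\<in>slices Q. E X Y \<in> extensional (Rel Q X Y) \<and>
        (\<forall>\<phi>\<in>Rel Q X Y. E X Y \<phi> \<in> Rel Q (F X) (F Y))))"
  by (auto simp: extension_families_def PiE_iff)

lemma extension_closed:
  "E \<in> extension_families Q T \<Longrightarrow> X \<in> slices Q \<Longrightarrow> Y \<in> slices Q \<Longrightarrow> \<phi> \<in> Rel Q X Y \<Longrightarrow>
    E X Y \<phi> \<in> Rel Q (F X) (F Y)"
  unfolding extension_families_iff by blast

lemma extension_at:
  "E \<in> extension_families Q T \<Longrightarrow> X \<in> slices Q \<Longrightarrow> Y \<in> slices Q \<Longrightarrow> \<phi> \<in> Rel Q X Y \<Longrightarrow>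
    a \<in> pts (F X) \<Longrightarrow> b \<in> pts (F Y) \<Longrightarrow> E X Y \<phi> a b \<in> Hom Q (ar (F X) a) (ar (F Y) b)"
  by (intro Rel_at[of "E X Y \<phi>" Q "F X" "F Y"] extension_closed[of E])

lemma extension_eqI:
  assumes "E \<in> extension_families Q T" and "E' \<in> extension_families Q T"
    and eq: "\<And>X Y \<phi> a b. X \<in> slices Q \<Longrightarrow> Y \<in> slices Q \<Longrightarrow> \<phi> \<in> Rel Q X Y \<Longrightarrow>
      a \<in> pts (F X) \<Longrightarrow> b \<in> pts (F Y) \<Longrightarrow> E X Y \<phi> a b = E' X Y \<phi> a b"
  shows "E = E'"
proof (rule extensionalityI[of _ "slices Q"])
  fix X assume X: "X \<in> slices Q"
  show "E X = E' X"
  proof (rule extensionalityI[of _ "slices Q"])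
    fix Y assume Y: "Y \<in> slices Q"
    show "E X Y = E' X Y"
    proof (rule extensionalityI[of _ "Rel Q X Y"])
      fix \<phi> assume "\<phi> \<in> Rel Q X Y"
      then show "E X Y \<phi> = E' X Y \<phi>"
        using X Y by (intro Rel_eqI[of _ Q "F X" "F Y"] extension_closed[OF assms(1)] extension_closed[OF assms(2)] eq)
    qed (use assms(1,2) X Y in \<open>simp_all add: extension_families_iff\<close>)
  qed (use assms(1,2) X in \<open>simp_all add: extension_families_iff\<close>)
qed (use assms(1,2) in \<open>simp_all add: extension_families_iff\<close>)

text \<open>
  The conditions on extension families, written on elements: the suprema in the composites are
  resolved into inequalities between single components. The first condition keeps its relational form,
  because it is an equality of relations; its elementwise form is derived below.
\<close>

definition commutes_with_restriction :: "'v family \<Rightarrow> bool" where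
  "commutes_with_restriction E \<longleftrightarrow>
    (\<forall>X\<in>slices Q. \<forall>Y\<in>slices Q. \<forall>Z\<in>slices Q. \<forall>\<phi>\<in>Rel Q X Y. \<forall>h\<in>smaps Z Y.
      E X Z (rcomp Q X Y Z (upper_star Q Z Y h) \<phi>) =
      rcomp Q (F X) (F Y) (F Z) (upper_star Q (F Z) (F Y) (Tmap T Z Y h)) (E X Y \<phi>))"

definition lax_identity :: "'v family \<Rightarrow> bool" where
  "lax_identity E \<longleftrightarrow>
    (\<forall>X\<in>slices Q. \<forall>a\<in>pts (F X). Le Q (Id Q (ar (F X) a)) (E X X (unit_rel X) a a))"

definition lax_composition :: "'v family \<Rightarrow> bool" where
  "lax_composition E \<longleftrightarrow>
    (\<forall>X\<in>slices Q. \<forall>Y\<in>slices Q. \<forall>Z\<in>slices Q. \<forall>\<phi>\<in>Rel Q X Y. \<forall>\<psi>\<in>Rel Q Y Z.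
      \<forall>a\<in>pts (F X). \<forall>b\<in>pts (F Y). \<forall>c\<in>pts (F Z).
        Le Q (E Y Z \<psi> b c \<cdot> E X Y \<phi> a b) (E X Z (rcomp Q X Y Z \<psi> \<phi>) a c))"

definition lax_unit :: "'v family \<Rightarrow> bool" where
  "lax_unit E \<longleftrightarrow>
    (\<forall>X\<in>slices Q. \<forall>Y\<in>slices Q. \<forall>\<phi>\<in>Rel Q X Y. \<forall>x\<in>pts X. \<forall>y\<in>pts Y.
      Le Q (\<phi> x y) (E X Y \<phi> (unit X x) (unit Y y)))"

definition lax_mult :: "'v family \<Rightarrow> bool" where
  "lax_mult E \<longleftrightarrow>
    (\<forall>X\<in>slices Q. \<forall>Y\<in>slices Q. \<forall>\<phi>\<in>Rel Q X Y. \<forall>A\<in>pts (F (F X)). \<forall>B\<in>pts (F (F Y)).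
      Le Q (E (F X) (F Y) (E X Y \<phi>) A B) (E X Y \<phi> (mult X A) (mult Y B)))"

definition preserves_lower_stars :: "'v family \<Rightarrow> bool" where
  "preserves_lower_stars E \<longleftrightarrow>
    (\<forall>X\<in>slices Q. \<forall>Y\<in>slices Q. \<forall>f\<in>smaps X Y. \<forall>a\<in>pts (F X).
      Le Q (Id Q (ar (F X) a)) (E X Y (lower_star Q X Y f) a (Tmap T X Y f a)))"

definition preserves_upper_stars :: "'v family \<Rightarrow> bool" where
  "preserves_upper_stars E \<longleftrightarrow>
    (\<forall>X\<in>slices Q. \<forall>Y\<in>slices Q. \<forall>f\<in>smaps X Y. \<forall>a\<in>pts (F X).
      Le Q (Id Q (ar (F X) a)) (E Y X (upper_star Q X Y f) (Tmap T X Y f a) a))"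

lemma commutes_with_restriction_iff:
  assumes E: "E \<in> extension_families Q T"
  shows "commutes_with_restriction E \<longleftrightarrow>
    (\<forall>X\<in>slices Q. \<forall>Y\<in>slices Q. \<forall>Z\<in>slices Q. \<forall>\<phi>\<in>Rel Q X Y. \<forall>h\<in>smaps Z Y.
      \<forall>a\<in>pts (F X). \<forall>c\<in>pts (F Z).
        E X Z (rcomp Q X Y Z (upper_star Q Z Y h) \<phi>) a c = E X Y \<phi> a (Tmap T Z Y h c))"
proof -
  have "E X Z (rcomp Q X Y Z (upper_star Q Z Y h) \<phi>) =
      rcomp Q (F X) (F Y) (F Z) (upper_star Q (F Z) (F Y) (Tmap T Z Y h)) (E X Y \<phi>) \<longleftrightarrow>
      (\<forall>a\<in>pts (F X). \<forall>c\<in>pts (F Z).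
        E X Z (rcomp Q X Y Z (upper_star Q Z Y h) \<phi>) a c = E X Y \<phi> a (Tmap T Z Y h c))"
      (is "?l = ?r \<longleftrightarrow> ?rhs")
    if "X \<in> slices Q" "Y \<in> slices Q" "Z \<in> slices Q" "\<phi> \<in> Rel Q X Y" "h \<in> smaps Z Y" for X Y Z \<phi> h
  proof -
    have l: "?l \<in> Rel Q (F X) (F Z)" and r: "?r \<in> Rel Q (F X) (F Z)"
      using that
      by (auto intro!: extension_closed[OF E] rcomp_closed upper_star_closed Tmap_closed Tob_closed)
    have at: "?r a c = E X Y \<phi> a (Tmap T Z Y h c)" if "a \<in> pts (F X)" "c \<in> pts (F Z)" for a c
      using \<open>X \<in> _\<close> \<open>Y \<in> _\<close> \<open>Z \<in> _\<close> \<open>\<phi> \<in> _\<close> \<open>h \<in> _\<close> that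
      by (intro rcomp_upper_star_at Tob_closed extension_closed[OF E] Tmap_closed)
    have "?l = ?r \<longleftrightarrow> (\<forall>a\<in>pts (F X). \<forall>c\<in>pts (F Z). ?l a c = ?r a c)"
      using Rel_eqI[OF l r] by metis
    then show ?thesis using at by simp
  qed
  then show ?thesis unfolding commutes_with_restriction_def by simp
qed

lemma lax_identity_iff:
  assumes E: "E \<in> extension_families Q T"
  shows "lax_identity E \<longleftrightarrow>
    (\<forall>X\<in>slices Q. rel_le Q (F X) (F X) (unit_rel (F X)) (E X X (unit_rel X)))"
proof -
  have "rel_le Q (F X) (F X) (unit_rel (F X)) (E X X (unit_rel X)) \<longleftrightarrow>
      (\<forall>a\<in>pts (F X). Le Q (Id Q (ar (F X) a)) (E X X (unit_rel X) a a))"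
    if X: "X \<in> slices Q" for X
    unfolding upper_star_le_iff[OF sid_closed extension_closed[OF E X X upper_star_closed[OF X X sid_closed]]]
    by (simp add: sid_def[of "F X"])
  then show ?thesis unfolding lax_identity_def by simp
qed

lemma lax_composition_iff:
  assumes E: "E \<in> extension_families Q T"
  shows "lax_composition E \<longleftrightarrow>
    (\<forall>X\<in>slices Q. \<forall>Y\<in>slices Q. \<forall>Z\<in>slices Q. \<forall>\<phi>\<in>Rel Q X Y. \<forall>\<psi>\<in>Rel Q Y Z.
      rel_le Q (F X) (F Z) (rcomp Q (F X) (F Y) (F Z) (E Y Z \<psi>) (E X Y \<phi>))
        (E X Z (rcomp Q X Y Z \<psi> \<phi>)))"
proof -
  have "rel_le Q (F X) (F Z) (rcomp Q (F X) (F Y) (F Z) (E Y Z \<psi>) (E X Y \<phi>)) (E X Z (rcomp Q X Y Z \<psi> \<phi>)) \<longleftrightarrow>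
      (\<forall>a\<in>pts (F X). \<forall>b\<in>pts (F Y). \<forall>c\<in>pts (F Z).
        Le Q (E Y Z \<psi> b c \<cdot> E X Y \<phi> a b) (E X Z (rcomp Q X Y Z \<psi> \<phi>) a c))"
    if "X \<in> slices Q" "Y \<in> slices Q" "Z \<in> slices Q" "\<phi> \<in> Rel Q X Y" "\<psi> \<in> Rel Q Y Z" for X Y Z \<phi> \<psi>
    using that by (intro rcomp_le_iff extension_closed[OF E] rcomp_closed)
  then show ?thesis unfolding lax_composition_def by simp
qed

lemma lax_unit_iff_upper_stars:
  assumes E: "E \<in> extension_families Q T"
  shows "lax_unit E \<longleftrightarrow> (\<forall>X\<in>slices Q. \<forall>Y\<in>slices Q. \<forall>\<phi>\<in>Rel Q X Y.
    rel_le Q (F X) Y (rcomp Q (F X) X Y \<phi> (upper_star Q X (F X) (unit X)))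
      (rcomp Q (F X) (F Y) Y (upper_star Q Y (F Y) (unit Y)) (E X Y \<phi>)))"
proof -
  have "rel_le Q (F X) Y (rcomp Q (F X) X Y \<phi> (upper_star Q X (F X) (unit X)))
        (rcomp Q (F X) (F Y) Y (upper_star Q Y (F Y) (unit Y)) (E X Y \<phi>)) \<longleftrightarrow>
      (\<forall>x\<in>pts X. \<forall>y\<in>pts Y. Le Q (\<phi> x y) (E X Y \<phi> (unit X x) (unit Y y)))"
    if X: "X \<in> slices Q" and Y: "Y \<in> slices Q" and \<phi>: "\<phi> \<in> Rel Q X Y" for X Y \<phi>
  proof -
    note FX = Tob_closed[OF X] and FY = Tob_closed[OF Y] and E\<phi> = extension_closed[OF E X Y \<phi>]
    note r = rcomp_closed[OF FX Y E\<phi> upper_star_closed[OF Y FY Tunit_closed[OF Y]]]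
    show ?thesis
      unfolding rcomp_upper_star_le_iff[OF X FX Y Tunit_closed[OF X] \<phi> r]
      using unit_at(1)[OF X] by (simp add: rcomp_upper_star_at[OF FX FY Y E\<phi> Tunit_closed[OF Y]])
  qed
  then show ?thesis unfolding lax_unit_def by simp
qed

lemma lax_mult_iff_upper_stars:
  assumes E: "E \<in> extension_families Q T"
  shows "lax_mult E \<longleftrightarrow> (\<forall>X\<in>slices Q. \<forall>Y\<in>slices Q. \<forall>\<phi>\<in>Rel Q X Y.
    rel_le Q (F X) (F (F Y))
      (rcomp Q (F X) (F (F X)) (F (F Y))
        (E (F X) (F Y) (E X Y \<phi>)) (upper_star Q (F (F X)) (F X) (mult X)))
      (rcomp Q (F X) (F Y) (F (F Y)) (upper_star Q (F (F Y)) (F Y) (mult Y)) (E X Y \<phi>)))"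
proof -
  have "rel_le Q (F X) (F (F Y))
        (rcomp Q (F X) (F (F X)) (F (F Y)) (E (F X) (F Y) (E X Y \<phi>)) (upper_star Q (F (F X)) (F X) (mult X)))
        (rcomp Q (F X) (F Y) (F (F Y)) (upper_star Q (F (F Y)) (F Y) (mult Y)) (E X Y \<phi>)) \<longleftrightarrow>
      (\<forall>A\<in>pts (F (F X)). \<forall>B\<in>pts (F (F Y)).
        Le Q (E (F X) (F Y) (E X Y \<phi>) A B) (E X Y \<phi> (mult X A) (mult Y B)))"
    if X: "X \<in> slices Q" and Y: "Y \<in> slices Q" and \<phi>: "\<phi> \<in> Rel Q X Y" for X Y \<phi>
  proof -
    note FX = Tob_closed[OF X] and FY = Tob_closed[OF Y] and E\<phi> = extension_closed[OF E X Y \<phi>]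
    note FFX = Tob_closed[OF FX] and FFY = Tob_closed[OF FY] and EE\<phi> = extension_closed[OF E FX FY E\<phi>]
    note r = rcomp_closed[OF FX FFY E\<phi> upper_star_closed[OF FFY FY Tmult_closed[OF Y]]]
    show ?thesis
      unfolding rcomp_upper_star_le_iff[OF FFX FX FFY Tmult_closed[OF X] EE\<phi> r]
      using mult_at(1)[OF X] by (simp add: rcomp_upper_star_at[OF FX FY FFY E\<phi> Tmult_closed[OF Y]])
  qed
  then show ?thesis unfolding lax_mult_def by simp
qed

lemma lax_extensions_iff:
  "E \<in> lax_extensions Q T \<longleftrightarrow> E \<in> monotone_extension_families Q T \<and>
    commutes_with_restriction E \<and> lax_identity E \<and> lax_composition E \<and> lax_unit E \<and> lax_mult E"
proof (cases "E \<in> extension_families Q T")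
  case True
  then show ?thesis
    by (simp only: lax_extensions_def mem_Collect_eq commutes_with_restriction_def
        lax_identity_iff lax_composition_iff lax_unit_iff_upper_stars lax_mult_iff_upper_stars)
qed (simp add: lax_extensions_def monotone_extension_families_def)


section \<open>Lax extensions through the stars of a map\<close>

lemma monotone_extension:
  "E \<in> monotone_extension_families Q T \<Longrightarrow> E \<in> extension_families Q T"
  by (simp add: monotone_extension_families_def)

lemma monotone_extension_at:
  assumes "E \<in> monotone_extension_families Q T" and "X \<in> slices Q" and "Y \<in> slices Q"
    and "\<phi> \<in> Rel Q X Y" and "\<phi>' \<in> Rel Q X Y" and "rel_le Q X Y \<phi> \<phi>'"
    and "a \<in> pts (F X)" and "b \<in> pts (F Y)"
  shows "Le Q (E X Y \<phi> a b) (E X Y \<phi>' a b)"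
proof -
  have "rel_le Q (F X) (F Y) (E X Y \<phi>) (E X Y \<phi>')"
    using assms unfolding monotone_extension_families_def by blast
  then show ?thesis using assms(7,8) by (simp add: rel_le_def)
qed

text \<open>
  Lax functoriality in the form in which it is applied: any bound of the composite will do.
\<close>

lemma lax_composition_le:
  assumes E: "E \<in> monotone_extension_families Q T" and "lax_composition E"
    and X: "X \<in> slices Q" and Y: "Y \<in> slices Q" and Z: "Z \<in> slices Q"
    and \<phi>: "\<phi> \<in> Rel Q X Y" and \<psi>: "\<psi> \<in> Rel Q Y Z" and \<chi>: "\<chi> \<in> Rel Q X Z"
    and le: "rel_le Q X Z (rcomp Q X Y Z \<psi> \<phi>) \<chi>"
    and a: "a \<in> pts (F X)" and b: "b \<in> pts (F Y)" and c: "c \<in> pts (F Z)"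
  shows "Le Q (E Y Z \<psi> b c \<cdot> E X Y \<phi> a b) (E X Z \<chi> a c)"
proof -
  note E' = monotone_extension[OF E]
  have comp: "rcomp Q X Y Z \<psi> \<phi> \<in> Rel Q X Z" using X Z \<phi> \<psi> by (rule rcomp_closed)
  show ?thesis
  proof (rule Le_trans)
    show "Le Q (E Y Z \<psi> b c \<cdot> E X Y \<phi> a b) (E X Z (rcomp Q X Y Z \<psi> \<phi>) a c)"
      using assms(2) X Y Z \<phi> \<psi> a b c unfolding lax_composition_def by blast
    show "Le Q (E X Z (rcomp Q X Y Z \<psi> \<phi>) a c) (E X Z \<chi> a c)"
      by (rule monotone_extension_at[OF E X Z comp \<chi> le a c])
    show "E Y Z \<psi> b c \<cdot> E X Y \<phi> a b \<in> Hom Q (ar (F X) a) (ar (F Z) c)"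
      using extension_at[OF E' X Y \<phi> a b] extension_at[OF E' Y Z \<psi> b c] by (rule Comp_closed)
  qed (use extension_at[OF E' X Z _ a c] comp \<chi> in blast)+
qed

text \<open>
  The identity at \<open>a\<close> lies below the value of \<open>E\<close> at \<open>upper_star f\<close> on \<open>(T f a, a)\<close>. Inserting it into
  a composite turns a bound of \<open>\<phi>\<close> by \<open>\<chi>\<close> along \<open>f\<close> into the same bound for the extended relations
  along \<open>T f\<close>. The next lemma is the dual statement for the targets
  of the relations and \<open>lower_star\<close>.
\<close>

lemma extension_le_along_source:
  assumes E: "E \<in> monotone_extension_families Q T" and "lax_composition E" and "preserves_upper_stars E"
    and X: "X \<in> slices Q" and Y: "Y \<in> slices Q" and Z: "Z \<in> slices Q" and f: "f \<in> smaps X Y"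
    and \<phi>: "\<phi> \<in> Rel Q X Z" and \<chi>: "\<chi> \<in> Rel Q Y Z"
    and le: "\<And>x z. x \<in> pts X \<Longrightarrow> z \<in> pts Z \<Longrightarrow> Le Q (\<phi> x z) (\<chi> (f x) z)"
    and a: "a \<in> pts (F X)" and c: "c \<in> pts (F Z)"
  shows "Le Q (E X Z \<phi> a c) (E Y Z \<chi> (Tmap T X Y f a) c)"
proof -
  note E' = monotone_extension[OF E] and fa = Tmap_at[OF X Y f a]
  note up = upper_star_closed[OF X Y f]
  have "rel_le Q Y Z (rcomp Q Y X Z \<phi> (upper_star Q X Y f)) \<chi>"
    using le rcomp_upper_star_le_iff[OF X Y Z f \<phi> \<chi>] by blast
  note * = lax_composition_le[OF E assms(2) Y X Z up \<phi> \<chi> this fa(1) a c]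
  have u: "E Y X (upper_star Q X Y f) (Tmap T X Y f a) a \<in> Hom Q (ar (F X) a) (ar (F X) a)"
    using extension_at[OF E' Y X up fa(1) a] fa(2) by simp
  have v: "E X Z \<phi> a c \<in> Hom Q (ar (F X) a) (ar (F Z) c)" by (rule extension_at[OF E' X Z \<phi> a c])
  show ?thesis
  proof (rule Le_trans[OF _ * v])
    show "Le Q (E X Z \<phi> a c) (E X Z \<phi> a c \<cdot> E Y X (upper_star Q X Y f) (Tmap T X Y f a) a)"
      using assms(3) X Y f a by (intro Le_Comp_right[OF v u]) (simp add: preserves_upper_stars_def)
    show "E Y Z \<chi> (Tmap T X Y f a) c \<in> Hom Q (ar (F X) a) (ar (F Z) c)"
      using extension_at[OF E' Y Z \<chi> fa(1) c] fa(2) by simp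
  qed (rule Comp_closed[OF u v])
qed

lemma extension_le_along_target:
  assumes E: "E \<in> monotone_extension_families Q T" and "lax_composition E" and "preserves_lower_stars E"
    and X: "X \<in> slices Q" and Y: "Y \<in> slices Q" and Z: "Z \<in> slices Q" and h: "h \<in> smaps Z Y"
    and \<phi>: "\<phi> \<in> Rel Q X Z" and \<chi>: "\<chi> \<in> Rel Q X Y"
    and le: "\<And>x z. x \<in> pts X \<Longrightarrow> z \<in> pts Z \<Longrightarrow> Le Q (\<phi> x z) (\<chi> x (h z))"
    and a: "a \<in> pts (F X)" and c: "c \<in> pts (F Z)"
  shows "Le Q (E X Z \<phi> a c) (E X Y \<chi> a (Tmap T Z Y h c))"
proof -
  note E' = monotone_extension[OF E] and hc = Tmap_at[OF Z Y h c]
  note low = lower_star_closed[OF Z Y h]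
  have "rel_le Q X Y (rcomp Q X Z Y (lower_star Q Z Y h) \<phi>) \<chi>"
    using le lower_star_rcomp_le_iff[OF X Z Y h \<phi> \<chi>] by blast
  note * = lax_composition_le[OF E assms(2) X Z Y \<phi> low \<chi> this a c hc(1)]
  have u: "E Z Y (lower_star Q Z Y h) c (Tmap T Z Y h c) \<in> Hom Q (ar (F Z) c) (ar (F Z) c)"
    using extension_at[OF E' Z Y low c hc(1)] hc(2) by simp
  have v: "E X Z \<phi> a c \<in> Hom Q (ar (F X) a) (ar (F Z) c)" by (rule extension_at[OF E' X Z \<phi> a c])
  show ?thesis
  proof (rule Le_trans[OF _ * v])
    show "Le Q (E X Z \<phi> a c) (E Z Y (lower_star Q Z Y h) c (Tmap T Z Y h c) \<cdot> E X Z \<phi> a c)"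
      using assms(3) Z Y h c by (intro Le_Comp_left[OF v u]) (simp add: preserves_lower_stars_def)
    show "E X Y \<chi> a (Tmap T Z Y h c) \<in> Hom Q (ar (F X) a) (ar (F Z) c)"
      using extension_at[OF E' X Y \<chi> a hc(1)] hc(2) by simp
  qed (rule Comp_closed[OF v u])
qed

lemma restriction_closed:
  "X \<in> slices Q \<Longrightarrow> Y \<in> slices Q \<Longrightarrow> Z \<in> slices Q \<Longrightarrow> \<phi> \<in> Rel Q X Y \<Longrightarrow> h \<in> smaps Z Y \<Longrightarrow>
    rcomp Q X Y Z (upper_star Q Z Y h) \<phi> \<in> Rel Q X Z"
  by (intro rcomp_closed upper_star_closed)

text \<open>
  One half of commutation with restriction: the identity below the value of \<open>E\<close> at
  \<open>upper_star h\<close> is inserted as a factor, and lax functoriality is applied.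
\<close>

lemma restriction_le_extension:
  assumes E: "E \<in> monotone_extension_families Q T" and "lax_composition E" and "preserves_upper_stars E"
    and X: "X \<in> slices Q" and Y: "Y \<in> slices Q" and Z: "Z \<in> slices Q" and h: "h \<in> smaps Z Y"
    and \<phi>: "\<phi> \<in> Rel Q X Y" and a: "a \<in> pts (F X)" and c: "c \<in> pts (F Z)"
  shows "Le Q (E X Y \<phi> a (Tmap T Z Y h c)) (E X Z (rcomp Q X Y Z (upper_star Q Z Y h) \<phi>) a c)"
proof -
  note E' = monotone_extension[OF E] and hc = Tmap_at[OF Z Y h c]
  note up = upper_star_closed[OF Z Y h] and r = restriction_closed[OF X Y Z \<phi> h]
  have *: "Le Q (E Y Z (upper_star Q Z Y h) (Tmap T Z Y h c) c \<cdot> E X Y \<phi> a (Tmap T Z Y h c))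
      (E X Z (rcomp Q X Y Z (upper_star Q Z Y h) \<phi>) a c)"
    using assms(2) X Y Z \<phi> up a hc(1) c unfolding lax_composition_def by blast
  have u: "E Y Z (upper_star Q Z Y h) (Tmap T Z Y h c) c \<in> Hom Q (ar (F Z) c) (ar (F Z) c)"
    using extension_at[OF E' Y Z up hc(1) c] hc(2) by simp
  have v: "E X Y \<phi> a (Tmap T Z Y h c) \<in> Hom Q (ar (F X) a) (ar (F Z) c)"
    using extension_at[OF E' X Y \<phi> a hc(1)] hc(2) by simp
  show ?thesis
  proof (rule Le_trans[OF _ * v])
    show "Le Q (E X Y \<phi> a (Tmap T Z Y h c))
        (E Y Z (upper_star Q Z Y h) (Tmap T Z Y h c) c \<cdot> E X Y \<phi> a (Tmap T Z Y h c))"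
      using assms(3) Z Y h c by (intro Le_Comp_left[OF v u]) (simp add: preserves_upper_stars_def)
  qed (rule Comp_closed[OF v u], rule extension_at[OF E' X Z r a c])
qed

text \<open>
  The relation \<open>upper_star f\<close> is the restriction of the identity relation along \<open>f\<close>.
\<close>

lemma preserves_upper_stars_if_commutes:
  assumes E: "E \<in> extension_families Q T" and "commutes_with_restriction E" and "lax_identity E"
  shows "preserves_upper_stars E"
  unfolding preserves_upper_stars_def
proof (intro ballI)
  fix X Y f a
  assume X: "X \<in> slices Q" and Y: "Y \<in> slices Q" and f: "f \<in> smaps X Y" and a: "a \<in> pts (F X)"
  note fa = Tmap_at[OF X Y f a] and up = upper_star_closed[OF X Y f]
    and one = upper_star_closed[OF Y Y sid_closed]
  have "upper_star Q X Y f = rcomp Q Y Y X (upper_star Q X Y f) (unit_rel Y)"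
  proof (rule Rel_eqI[OF up restriction_closed[OF Y Y X one f]])
    fix y x assume "y \<in> pts Y" "x \<in> pts X"
    then show "upper_star Q X Y f y x = rcomp Q Y Y X (upper_star Q X Y f) (unit_rel Y) y x"
      using smaps_at[OF f] by (simp add: rcomp_upper_star_at[OF Y Y X one f]) (auto simp: upper_star_def sid_def)
  qed
  then have "E Y X (upper_star Q X Y f) (Tmap T X Y f a) a =
      E Y Y (unit_rel Y) (Tmap T X Y f a) (Tmap T X Y f a)"
    using assms(2) X Y f a fa(1) one unfolding commutes_with_restriction_iff[OF E] by metis
  then show "Le Q (Id Q (ar (F X) a)) (E Y X (upper_star Q X Y f) (Tmap T X Y f a) a)"
    using assms(3) Y fa unfolding lax_identity_def by metis
qed

text \<open>
  The value of \<open>E\<close> at \<open>lower_star f\<close> on \<open>(a, T f a)\<close> is its value on \<open>(a, a)\<close> at the restriction of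
  \<open>lower_star f\<close> along \<open>f\<close>, and this restriction lies above the identity relation by the unit of the
  adjunction between the stars.
\<close>

lemma preserves_lower_stars_if_commutes:
  assumes E: "E \<in> monotone_extension_families Q T"
    and "commutes_with_restriction E" and "lax_identity E"
  shows "preserves_lower_stars E"
  unfolding preserves_lower_stars_def
proof (intro ballI)
  fix X Y f a
  assume X: "X \<in> slices Q" and Y: "Y \<in> slices Q" and f: "f \<in> smaps X Y" and a: "a \<in> pts (F X)"
  note E' = monotone_extension[OF E]
  note fa = Tmap_at[OF X Y f a] and low = lower_star_closed[OF X Y f]
    and one = upper_star_closed[OF X X sid_closed]
  note r = restriction_closed[OF X Y X low f]
  let ?r = "rcomp Q X Y X (upper_star Q X Y f) (lower_star Q X Y f)"
  have eq: "E X X ?r a a = E X Y (lower_star Q X Y f) a (Tmap T X Y f a)"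
    using assms(2) X Y f low a unfolding commutes_with_restriction_iff[OF E'] by blast
  have "Le Q (Id Q (ar X x)) (?r x x)" if x: "x \<in> pts X" for x
    using x smaps_at[OF f x] Le_refl[OF Id_closed[OF slices_at[OF X x]]]
    by (simp add: rcomp_upper_star_at[OF X Y X low f x x]) (simp add: lower_star_def)
  then have "rel_le Q X X (unit_rel X) ?r"
    unfolding upper_star_le_iff[OF sid_closed r] by (simp add: sid_def)
  note * = monotone_extension_at[OF E X X one r this a a]
  have 1: "Le Q (Id Q (ar (F X) a)) (E X X (unit_rel X) a a)"
    using assms(3) X a by (simp add: lax_identity_def)
  have "Le Q (Id Q (ar (F X) a)) (E X X ?r a a)"
    using extension_at[OF E' X X one a a] extension_at[OF E' X X r a a]
      Id_closed[OF slices_at[OF Tob_closed[OF X] a]] by (rule Le_trans[OF 1 *, rotated])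
  then show "Le Q (Id Q (ar (F X) a)) (E X Y (lower_star Q X Y f) a (Tmap T X Y f a))"
    by (simp only: eq)
qed

text \<open>
  The inequality that is not \<open>restriction_le_extension\<close> comes from the counit of the adjunction
  between the stars: restricting \<open>\<phi>\<close> along \<open>h\<close> and composing with \<open>lower_star h\<close> stays below \<open>\<phi>\<close>.
\<close>

lemma commutes_with_restriction_if_preserves_stars:
  assumes E: "E \<in> monotone_extension_families Q T" and "lax_composition E"
    and "preserves_lower_stars E" and "preserves_upper_stars E"
  shows "commutes_with_restriction E"
  unfolding commutes_with_restriction_iff[OF monotone_extension[OF E]]
proof (intro ballI)
  fix X Y Z \<phi> h a c
  assume X: "X \<in> slices Q" and Y: "Y \<in> slices Q" and Z: "Z \<in> slices Q"
    and \<phi>: "\<phi> \<in> Rel Q X Y" and h: "h \<in> smaps Z Y" and a: "a \<in> pts (F X)" and c: "c \<in> pts (F Z)"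
  note E' = monotone_extension[OF E]
  note r = restriction_closed[OF X Y Z \<phi> h] and hc = Tmap_at[OF Z Y h c]
  let ?r = "rcomp Q X Y Z (upper_star Q Z Y h) \<phi>"
  have le: "Le Q (?r x z) (\<phi> x (h z))" if "x \<in> pts X" "z \<in> pts Z" for x z
    using Le_refl[OF Rel_at[OF \<phi> that(1) smaps_at(1)[OF h that(2)]]]
    by (simp add: rcomp_upper_star_at[OF X Y Z \<phi> h that])
  show "E X Z ?r a c = E X Y \<phi> a (Tmap T Z Y h c)"
  proof (rule Le_antisym)
    show "Le Q (E X Z ?r a c) (E X Y \<phi> a (Tmap T Z Y h c))"
      by (rule extension_le_along_target[OF E assms(2,3) X Y Z h r \<phi> le a c])
    show "Le Q (E X Y \<phi> a (Tmap T Z Y h c)) (E X Z ?r a c)"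
      by (rule restriction_le_extension[OF E assms(2,4) X Y Z h \<phi> a c])
    show "E X Z ?r a c \<in> Hom Q (ar (F X) a) (ar (F Z) c)"
      by (rule extension_at[OF E' X Z r a c])
    show "E X Y \<phi> a (Tmap T Z Y h c) \<in> Hom Q (ar (F X) a) (ar (F Z) c)"
      using extension_at[OF E' X Y \<phi> a hc(1)] hc(2) by simp
  qed
qed

lemma lax_identity_if_preserves_upper_stars:
  assumes "preserves_upper_stars E"
  shows "lax_identity E"
  unfolding lax_identity_def
proof (intro ballI)
  fix X a assume X: "X \<in> slices Q" and a: "a \<in> pts (F X)"
  have "Le Q (Id Q (ar (F X) a)) (E X X (unit_rel X) (Tmap T X X (sid X) a) a)"
    using assms X a sid_closed unfolding preserves_upper_stars_def by blast
  then show "Le Q (Id Q (ar (F X) a)) (E X X (unit_rel X) a a)"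
    by (simp add: Tmap_id_at[OF X a])
qed

lemma lax_extensions_iff_preserves_stars:
  "E \<in> lax_extensions Q T \<longleftrightarrow> E \<in> monotone_extension_families Q T \<and>
    preserves_lower_stars E \<and> preserves_upper_stars E \<and> lax_composition E \<and> lax_unit E \<and> lax_mult E"
  unfolding lax_extensions_iff
  using preserves_upper_stars_if_commutes[OF monotone_extension] preserves_lower_stars_if_commutes
    commutes_with_restriction_if_preserves_stars lax_identity_if_preserves_upper_stars
  by blast

lemma preserves_lower_stars_iff:
  assumes E: "E \<in> extension_families Q T"
  shows "preserves_lower_stars E \<longleftrightarrow> (\<forall>X\<in>slices Q. \<forall>Y\<in>slices Q. \<forall>f\<in>smaps X Y.
    rel_le Q (F X) (F Y) (lower_star Q (F X) (F Y) (Tmap T X Y f)) (E X Y (lower_star Q X Y f)))"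
proof -
  have "rel_le Q (F X) (F Y) (lower_star Q (F X) (F Y) (Tmap T X Y f)) (E X Y (lower_star Q X Y f)) \<longleftrightarrow>
      (\<forall>a\<in>pts (F X). Le Q (Id Q (ar (F X) a)) (E X Y (lower_star Q X Y f) a (Tmap T X Y f a)))"
    if "X \<in> slices Q" "Y \<in> slices Q" "f \<in> smaps X Y" for X Y f
    using that by (intro lower_star_le_iff Tmap_closed extension_closed[OF E] lower_star_closed)
  then show ?thesis unfolding preserves_lower_stars_def by simp
qed

lemma preserves_upper_stars_iff:
  assumes E: "E \<in> extension_families Q T"
  shows "preserves_upper_stars E \<longleftrightarrow> (\<forall>X\<in>slices Q. \<forall>Y\<in>slices Q. \<forall>f\<in>smaps X Y.
    rel_le Q (F Y) (F X) (upper_star Q (F X) (F Y) (Tmap T X Y f)) (E Y X (upper_star Q X Y f)))"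
proof -
  have "rel_le Q (F Y) (F X) (upper_star Q (F X) (F Y) (Tmap T X Y f)) (E Y X (upper_star Q X Y f)) \<longleftrightarrow>
      (\<forall>a\<in>pts (F X). Le Q (Id Q (ar (F X) a)) (E Y X (upper_star Q X Y f) (Tmap T X Y f a) a))"
    if "X \<in> slices Q" "Y \<in> slices Q" "f \<in> smaps X Y" for X Y f
    using that by (intro upper_star_le_iff Tmap_closed extension_closed[OF E] upper_star_closed)
  then show ?thesis unfolding preserves_upper_stars_def by simp
qed

lemma lax_unit_iff_lower_stars:
  assumes E: "E \<in> extension_families Q T"
  shows "lax_unit E \<longleftrightarrow> (\<forall>X\<in>slices Q. \<forall>Y\<in>slices Q. \<forall>\<phi>\<in>Rel Q X Y.
    rel_le Q X (F Y)
      (rcomp Q X Y (F Y) (lower_star Q Y (F Y) (unit Y)) \<phi>)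
      (rcomp Q X (F X) (F Y) (E X Y \<phi>) (lower_star Q X (F X) (unit X))))"
proof -
  have "rel_le Q X (F Y) (rcomp Q X Y (F Y) (lower_star Q Y (F Y) (unit Y)) \<phi>)
        (rcomp Q X (F X) (F Y) (E X Y \<phi>) (lower_star Q X (F X) (unit X))) \<longleftrightarrow>
      (\<forall>x\<in>pts X. \<forall>y\<in>pts Y. Le Q (\<phi> x y) (E X Y \<phi> (unit X x) (unit Y y)))"
    if X: "X \<in> slices Q" and Y: "Y \<in> slices Q" and \<phi>: "\<phi> \<in> Rel Q X Y" for X Y \<phi>
  proof -
    note FX = Tob_closed[OF X] and FY = Tob_closed[OF Y] and E\<phi> = extension_closed[OF E X Y \<phi>]
    note r = rcomp_closed[OF X FY lower_star_closed[OF X FX Tunit_closed[OF X]] E\<phi>]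
    show ?thesis
      unfolding lower_star_rcomp_le_iff[OF X Y FY Tunit_closed[OF Y] \<phi> r]
      using unit_at(1)[OF Y] by (simp add: rcomp_lower_star_at[OF X FX FY Tunit_closed[OF X] E\<phi>])
  qed
  then show ?thesis unfolding lax_unit_def by simp
qed

lemma lax_mult_iff_lower_stars:
  assumes E: "E \<in> extension_families Q T"
  shows "lax_mult E \<longleftrightarrow> (\<forall>X\<in>slices Q. \<forall>Y\<in>slices Q. \<forall>\<phi>\<in>Rel Q X Y.
    rel_le Q (F (F X)) (F Y)
      (rcomp Q (F (F X)) (F (F Y)) (F Y)
        (lower_star Q (F (F Y)) (F Y) (mult Y)) (E (F X) (F Y) (E X Y \<phi>)))
      (rcomp Q (F (F X)) (F X) (F Y) (E X Y \<phi>) (lower_star Q (F (F X)) (F X) (mult X))))"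
proof -
  have "rel_le Q (F (F X)) (F Y)
        (rcomp Q (F (F X)) (F (F Y)) (F Y) (lower_star Q (F (F Y)) (F Y) (mult Y)) (E (F X) (F Y) (E X Y \<phi>)))
        (rcomp Q (F (F X)) (F X) (F Y) (E X Y \<phi>) (lower_star Q (F (F X)) (F X) (mult X))) \<longleftrightarrow>
      (\<forall>A\<in>pts (F (F X)). \<forall>B\<in>pts (F (F Y)).
        Le Q (E (F X) (F Y) (E X Y \<phi>) A B) (E X Y \<phi> (mult X A) (mult Y B)))"
    if X: "X \<in> slices Q" and Y: "Y \<in> slices Q" and \<phi>: "\<phi> \<in> Rel Q X Y" for X Y \<phi>
  proof -
    note FX = Tob_closed[OF X] and FY = Tob_closed[OF Y] and E\<phi> = extension_closed[OF E X Y \<phi>]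
    note FFX = Tob_closed[OF FX] and FFY = Tob_closed[OF FY] and EE\<phi> = extension_closed[OF E FX FY E\<phi>]
    note r = rcomp_closed[OF FFX FY lower_star_closed[OF FFX FX Tmult_closed[OF X]] E\<phi>]
    show ?thesis
      unfolding lower_star_rcomp_le_iff[OF FFX FFY FY Tmult_closed[OF Y] EE\<phi> r]
      using mult_at(1)[OF Y] by (simp add: rcomp_lower_star_at[OF FFX FX FY Tmult_closed[OF X] E\<phi>])
  qed
  then show ?thesis unfolding lax_mult_def by simp
qed


section \<open>Families of maps as extension families\<close>

definition law_families :: "('v slice \<Rightarrow> 'v \<Rightarrow> 'v) set" where
  "law_families = (\<Pi>\<^sub>E X\<in>slices Q. smaps (F (P X)) (P (F X)))"

lemma law_closed: "l \<in> law_families \<Longrightarrow> X \<in> slices Q \<Longrightarrow> l X \<in> smaps (F (P X)) (P (F X))"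
  unfolding law_families_def by (rule PiE_mem)

lemma law_hom:
  assumes "l \<in> law_families" and "X \<in> slices Q" and "s \<in> pts (F (P X))" and "a \<in> pts (F X)"
  shows "fam_at (l X s) a \<in> Hom Q (ar (F X) a) (ar (F (P X)) s)"
  using Pob_at'[OF Tob_closed[OF assms(2)] smaps_at(1)[OF law_closed[OF assms(1,2)] assms(3)] assms(4)]
    smaps_at(2)[OF law_closed[OF assms(1,2)] assms(3)] by simp

lemma ext_of_law_map_closed:
  "l \<in> law_families \<Longrightarrow> X \<in> slices Q \<Longrightarrow> Y \<in> slices Q \<Longrightarrow> g \<in> smaps Y (P X) \<Longrightarrow>
    slcomp (F Y) (l X) (Tmap T Y (P X) g) \<in> smaps (F Y) (P (F X))"
  by (rule slcomp_closed[OF Tmap_closed law_closed]) (auto intro: Pob_closed)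

lemma ext_of_law_eq:
  assumes "l \<in> law_families" and "X \<in> slices Q" and "Y \<in> slices Q" and "\<phi> \<in> Rel Q X Y"
  shows "ext_of_law Q T l X Y \<phi> =
    rarrow (F X) (F Y) (slcomp (F Y) (l X) (Tmap T Y (P X) (larrow X Y \<phi>)))"
  using assms by (simp add: ext_of_law_def the_inv_into_larrow Tob_closed ext_of_law_map_closed larrow_closed)

lemma larrow_ext_of_law:
  assumes "l \<in> law_families" and "X \<in> slices Q" and "Y \<in> slices Q" and "\<phi> \<in> Rel Q X Y"
  shows "larrow (F X) (F Y) (ext_of_law Q T l X Y \<phi>) =
    slcomp (F Y) (l X) (Tmap T Y (P X) (larrow X Y \<phi>))"
  unfolding ext_of_law_eq[OF assms]
  using assms by (intro larrow_rarrow Tob_closed ext_of_law_map_closed larrow_closed)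

lemma ext_of_law_at:
  assumes "l \<in> law_families" and "X \<in> slices Q" and "Y \<in> slices Q" and "\<phi> \<in> Rel Q X Y"
    and "a \<in> pts (F X)" and "b \<in> pts (F Y)"
  shows "ext_of_law Q T l X Y \<phi> a b = fam_at (l X (Tmap T Y (P X) (larrow X Y \<phi>) b)) a"
  unfolding ext_of_law_eq[OF assms(1-4)] using assms(5,6) by (simp add: rarrow_at compose_eq)

lemma ext_of_law_closed:
  assumes "l \<in> law_families"
  shows "ext_of_law Q T l \<in> extension_families Q T"
proof -
  have "ext_of_law Q T l X Y \<phi> \<in> Rel Q (F X) (F Y)"
    if "X \<in> slices Q" "Y \<in> slices Q" "\<phi> \<in> Rel Q X Y" for X Y \<phi>
    unfolding ext_of_law_eq[OF assms that]
    using that assms by (intro rarrow_closed Tob_closed ext_of_law_map_closed larrow_closed)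
  then show ?thesis
    unfolding extension_families_iff by (simp add: ext_of_law_def)
qed

text \<open>
  The law is recovered from its extension because the transpose of \<open>eps\<close> is an identity map.
\<close>

lemma law_at:
  assumes "l \<in> law_families" and "X \<in> slices Q" and "s \<in> pts (F (P X))" and "a \<in> pts (F X)"
  shows "fam_at (l X s) a = ext_of_law Q T l X (P X) (eps Q X) a s"
  using assms
  by (simp add: ext_of_law_at Pob_closed eps_closed larrow_eps Tmap_id_at)

lemma larrow_restriction:
  assumes "X \<in> slices Q" and "Y \<in> slices Q" and "Z \<in> slices Q" and "\<phi> \<in> Rel Q X Y" and "h \<in> smaps Z Y"
  shows "larrow X Z (rcomp Q X Y Z (upper_star Q Z Y h) \<phi>) = slcomp Z (larrow X Y \<phi>) h"
proof (rule Pob_map_eqI[OF assms(1)])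
  show "larrow X Z (rcomp Q X Y Z (upper_star Q Z Y h) \<phi>) \<in> smaps Z (P X)"
    by (rule larrow_closed[OF assms(3) restriction_closed[OF assms]])
  show "slcomp Z (larrow X Y \<phi>) h \<in> smaps Z (P X)"
    by (rule slcomp_closed[OF assms(5) larrow_closed[OF assms(2,4)]])
qed (use assms smaps_at(1)[OF assms(5)] in
    \<open>simp add: larrow_at rcomp_upper_star_at compose_eq\<close>)

text \<open>
  Transposition turns restriction along \<open>h\<close> into precomposition with \<open>h\<close>, and \<open>T\<close> preserves
  composition.
\<close>

lemma ext_of_law_commutes:
  assumes l: "l \<in> law_families"
  shows "commutes_with_restriction (ext_of_law Q T l)"
  unfolding commutes_with_restriction_iff[OF ext_of_law_closed[OF l]]
proof (intro ballI)
  fix X Y Z \<phi> h a c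
  assume X: "X \<in> slices Q" and Y: "Y \<in> slices Q" and Z: "Z \<in> slices Q"
    and \<phi>: "\<phi> \<in> Rel Q X Y" and h: "h \<in> smaps Z Y" and a: "a \<in> pts (F X)" and c: "c \<in> pts (F Z)"
  have "Tmap T Z (P X) (slcomp Z (larrow X Y \<phi>) h) c = Tmap T Y (P X) (larrow X Y \<phi>) (Tmap T Z Y h c)"
    by (rule Tmap_comp_at[OF Z Y Pob_closed[OF X] h larrow_closed[OF Y \<phi>] c])
  then show "ext_of_law Q T l X Z (rcomp Q X Y Z (upper_star Q Z Y h) \<phi>) a c =
      ext_of_law Q T l X Y \<phi> a (Tmap T Z Y h c)"
    by (simp add: ext_of_law_at[OF l X Z restriction_closed[OF X Y Z \<phi> h] a c]
        ext_of_law_at[OF l X Y \<phi> a Tmap_at(1)[OF Z Y h c]] larrow_restriction[OF X Y Z \<phi> h])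
qed

lemma law_of_ext_closed:
  assumes "E \<in> extension_families Q T"
  shows "law_of_ext Q T E \<in> law_families"
  unfolding law_families_def law_of_ext_def
  using assms by (auto intro!: larrow_closed Tob_closed Pob_closed extension_closed[OF assms] eps_closed)

lemma law_of_ext_ext_of_law:
  assumes l: "l \<in> law_families"
  shows "law_of_ext Q T (ext_of_law Q T l) = l"
proof (rule PiE_ext)
  show "law_of_ext Q T (ext_of_law Q T l) \<in> (\<Pi>\<^sub>E X\<in>slices Q. smaps (F (P X)) (P (F X)))"
    using law_of_ext_closed[OF ext_of_law_closed[OF l]] by (simp add: law_families_def)
  show "l \<in> (\<Pi>\<^sub>E X\<in>slices Q. smaps (F (P X)) (P (F X)))"
    using l by (simp add: law_families_def)
  fix X assume X: "X \<in> slices Q"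
  show "law_of_ext Q T (ext_of_law Q T l) X = l X"
    by (rule Pob_map_eqI[OF Tob_closed[OF X] law_closed[OF law_of_ext_closed[OF ext_of_law_closed[OF l]] X] law_closed[OF l X]])
      (use X in \<open>simp add: law_of_ext_def larrow_at Tob_closed law_at[OF l X]\<close>)
qed

text \<open>
  The evaluation relation is universal; therefore a family that commutes with restriction is
  determined by its values at the relations \<open>eps\<close>.
\<close>

lemma restriction_eps_larrow:
  assumes X: "X \<in> slices Q" and Y: "Y \<in> slices Q" and \<phi>: "\<phi> \<in> Rel Q X Y"
  shows "rcomp Q X (P X) Y (upper_star Q Y (P X) (larrow X Y \<phi>)) (eps Q X) = \<phi>"
proof (rule Rel_eqI[OF restriction_closed[OF X Pob_closed[OF X] Y eps_closed[OF X] larrow_closed[OF Y \<phi>]] \<phi>])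
  fix x y assume "x \<in> pts X" "y \<in> pts Y"
  then show "rcomp Q X (P X) Y (upper_star Q Y (P X) (larrow X Y \<phi>)) (eps Q X) x y = \<phi> x y"
    using smaps_at(1)[OF larrow_closed[OF Y \<phi>]]
    by (simp add: rcomp_upper_star_at[OF X Pob_closed[OF X] Y eps_closed[OF X] larrow_closed[OF Y \<phi>]] larrow_at[OF X])
qed

text \<open>
  Both families commute with restriction and agree at the evaluation relations, hence everywhere.
\<close>

lemma ext_of_law_law_of_ext:
  assumes E: "E \<in> extension_families Q T" and "commutes_with_restriction E"
  shows "ext_of_law Q T (law_of_ext Q T E) = E"
proof (rule extension_eqI[OF ext_of_law_closed[OF law_of_ext_closed[OF E]] E])
  fix X Y \<phi> a b
  assume X: "X \<in> slices Q" and Y: "Y \<in> slices Q" and \<phi>: "\<phi> \<in> Rel Q X Y"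
    and a: "a \<in> pts (F X)" and b: "b \<in> pts (F Y)"
  note PX = Pob_closed[OF X] and g = larrow_closed[OF Y \<phi>]
  have "ext_of_law Q T (law_of_ext Q T E) X Y \<phi> a b =
      E X (P X) (eps Q X) a (Tmap T Y (P X) (larrow X Y \<phi>) b)"
    unfolding ext_of_law_at[OF law_of_ext_closed[OF E] X Y \<phi> a b]
    using X Tmap_at(1)[OF Y PX g b] by (simp add: law_of_ext_def larrow_at Tob_closed a)
  also have "\<dots> = E X Y (rcomp Q X (P X) Y (upper_star Q Y (P X) (larrow X Y \<phi>)) (eps Q X)) a b"
    using assms(2) X Y PX g eps_closed[OF X] a b unfolding commutes_with_restriction_iff[OF E] by simp
  finally show "ext_of_law Q T (law_of_ext Q T E) X Y \<phi> a b = E X Y \<phi> a b"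
    by (simp only: restriction_eps_larrow[OF X Y \<phi>])
qed


section \<open>The axioms of a distributive law, pointwise\<close>

text \<open>
  The axioms of a monotone distributive law in terms of components. The direct images and the
  multiplication of the presheaf monad that are applied last occur on the smaller side of an
  inequality, so their suprema resolve into conditions on single components.
\<close>

definition law_natural :: "('v slice \<Rightarrow> 'v \<Rightarrow> 'v) \<Rightarrow> bool" where
  "law_natural l \<longleftrightarrow> (\<forall>X\<in>slices Q. \<forall>Y\<in>slices Q. \<forall>f\<in>smaps X Y. \<forall>s\<in>pts (F (P X)). \<forall>a\<in>pts (F X).
    Le Q (fam_at (l X s) a) (fam_at (l Y (Tmap T (P X) (P Y) (Pmap Q X Y f) s)) (Tmap T X Y f a)))"

definition law_Punit :: "('v slice \<Rightarrow> 'v \<Rightarrow> 'v) \<Rightarrow> bool" where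
  "law_Punit l \<longleftrightarrow> (\<forall>X\<in>slices Q. \<forall>a\<in>pts (F X).
    Le Q (Id Q (ar (F X) a)) (fam_at (l X (Tmap T X (P X) (Punit Q X) a)) a))"

definition law_Pmult :: "('v slice \<Rightarrow> 'v \<Rightarrow> 'v) \<Rightarrow> bool" where
  "law_Pmult l \<longleftrightarrow> (\<forall>X\<in>slices Q. \<forall>S\<in>pts (F (P (P X))). \<forall>s\<in>pts (F (P X)). \<forall>a\<in>pts (F X).
    Le Q (fam_at (l (P X) S) s \<cdot> fam_at (l X s) a)
      (fam_at (l X (Tmap T (P (P X)) (P X) (Pmult Q X) S)) a))"

definition law_unit :: "('v slice \<Rightarrow> 'v \<Rightarrow> 'v) \<Rightarrow> bool" where
  "law_unit l \<longleftrightarrow> (\<forall>X\<in>slices Q. \<forall>p\<in>pts (P X). \<forall>x\<in>pts X.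
    Le Q (fam_at p x) (fam_at (l X (unit (P X) p)) (unit X x)))"

definition law_mult :: "('v slice \<Rightarrow> 'v \<Rightarrow> 'v) \<Rightarrow> bool" where
  "law_mult l \<longleftrightarrow> (\<forall>X\<in>slices Q. \<forall>S\<in>pts (F (F (P X))). \<forall>A\<in>pts (F (F X)).
    Le Q (fam_at (l (F X) (Tmap T (F (P X)) (P (F X)) (l X) S)) A)
      (fam_at (l X (mult (P X) S)) (mult X A)))"

definition law_monotone :: "('v slice \<Rightarrow> 'v \<Rightarrow> 'v) \<Rightarrow> bool" where
  "law_monotone l \<longleftrightarrow> (\<forall>X\<in>slices Q. \<forall>Y\<in>slices Q. \<forall>f\<in>smaps Y (P X). \<forall>g\<in>smaps Y (P X).
    Pmap_le Q Y X f g \<longrightarrow> (\<forall>b\<in>pts (F Y). \<forall>a\<in>pts (F X).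
      Le Q (fam_at (l X (Tmap T Y (P X) f b)) a) (fam_at (l X (Tmap T Y (P X) g b)) a)))"

lemma law_natural_iff:
  assumes l: "l \<in> law_families"
  shows "law_natural l \<longleftrightarrow> (\<forall>X\<in>slices Q. \<forall>Y\<in>slices Q. \<forall>f\<in>smaps X Y.
    Pmap_le Q (F (P X)) (F Y)
      (slcomp (F (P X)) (Pmap Q (F X) (F Y) (Tmap T X Y f)) (l X))
      (slcomp (F (P X)) (l Y) (Tmap T (P X) (P Y) (Pmap Q X Y f))))"
proof -
  have "Pmap_le Q (F (P X)) (F Y)
      (slcomp (F (P X)) (Pmap Q (F X) (F Y) (Tmap T X Y f)) (l X))
      (slcomp (F (P X)) (l Y) (Tmap T (P X) (P Y) (Pmap Q X Y f))) \<longleftrightarrow>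
    (\<forall>s\<in>pts (F (P X)). \<forall>a\<in>pts (F X).
      Le Q (fam_at (l X s) a) (fam_at (l Y (Tmap T (P X) (P Y) (Pmap Q X Y f) s)) (Tmap T X Y f a)))"
    if X: "X \<in> slices Q" and Y: "Y \<in> slices Q" and f: "f \<in> smaps X Y" for X Y f
  proof -
    note FX = Tob_closed[OF X] and FY = Tob_closed[OF Y] and PX = Pob_closed[OF X] and PY = Pob_closed[OF Y]
    note Tf = Tmap_closed[OF X Y f] and Pf = Pmap_closed[OF X Y f]
    note TPf = Tmap_closed[OF PX PY Pf]
    have "(\<forall>b\<in>pts (F Y). Le Q (fam_at (Pmap Q (F X) (F Y) (Tmap T X Y f) (l X s)) b)
          (fam_at (l Y (Tmap T (P X) (P Y) (Pmap Q X Y f) s)) b)) \<longleftrightarrow>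
        (\<forall>a\<in>pts (F X). Le Q (fam_at (l X s) a)
          (fam_at (l Y (Tmap T (P X) (P Y) (Pmap Q X Y f) s)) (Tmap T X Y f a)))"
      if s: "s \<in> pts (F (P X))" for s
    proof (rule Pmap_le_at_iff[OF FX FY Tf smaps_at(1)[OF law_closed[OF l X] s]])
      fix b assume "b \<in> pts (F Y)"
      then show "fam_at (l Y (Tmap T (P X) (P Y) (Pmap Q X Y f) s)) b \<in> Hom Q (ar (F Y) b) (fam_cod (l X s))"
        using law_hom[OF l Y smaps_at(1)[OF TPf s], of b] smaps_at(2)[OF TPf s]
          smaps_at[OF law_closed[OF l X] s] by (simp add: Pob_ar)
    qed
    then show ?thesis
      unfolding Pmap_le_iff[OF slcomp_closed[OF law_closed[OF l X] Pmap_closed[OF FX FY Tf]]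
          slcomp_closed[OF TPf law_closed[OF l Y]]]
      by (simp add: compose_eq)
  qed
  then show ?thesis unfolding law_natural_def by simp
qed

lemma law_Punit_iff:
  assumes l: "l \<in> law_families"
  shows "law_Punit l \<longleftrightarrow> (\<forall>X\<in>slices Q.
    Pmap_le Q (F X) (F X) (Punit Q (F X)) (slcomp (F X) (l X) (Tmap T X (P X) (Punit Q X))))"
proof -
  have "Pmap_le Q (F X) (F X) (Punit Q (F X)) (slcomp (F X) (l X) (Tmap T X (P X) (Punit Q X))) \<longleftrightarrow>
      (\<forall>a\<in>pts (F X). Le Q (Id Q (ar (F X) a)) (fam_at (l X (Tmap T X (P X) (Punit Q X) a)) a))"
    if X: "X \<in> slices Q" for X
  proof -
    note FX = Tob_closed[OF X] and PX = Pob_closed[OF X] and y = Punit_closed[OF X]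
    note Ty = Tmap_closed[OF X PX y]
    let ?w = "\<lambda>a b. fam_at (l X (Tmap T X (P X) (Punit Q X) b)) a"
    have hom: "?w a b \<in> Hom Q (ar (F X) a) (ar (F X) b)" if "a \<in> pts (F X)" "b \<in> pts (F X)" for a b
      using law_hom[OF l X smaps_at(1)[OF Ty that(2)] that(1)] smaps_at(2)[OF Ty that(2)] by simp
    have "Le Q (fam_at (Punit Q (F X) b) a) (?w a b) \<longleftrightarrow> (a = b \<longrightarrow> Le Q (Id Q (ar (F X) b)) (?w a b))"
      if "a \<in> pts (F X)" "b \<in> pts (F X)" for a b
      using that bot_hom_least[OF hom[OF that]]
      by (simp add: Punit_def fam_at_fam slices_small[OF FX])
    then show ?thesis
      unfolding Pmap_le_iff[OF Punit_closed[OF FX] slcomp_closed[OF Ty law_closed[OF l X]]]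
      by (auto simp: compose_eq)
  qed
  then show ?thesis unfolding law_Punit_def by simp
qed

lemma law_Pmult_iff:
  assumes l: "l \<in> law_families"
  shows "law_Pmult l \<longleftrightarrow> (\<forall>X\<in>slices Q.
    Pmap_le Q (F (P (P X))) (F X)
      (slcomp (F (P (P X))) (Pmult Q (F X))
        (slcomp (F (P (P X))) (Pmap Q (F (P X)) (P (F X)) (l X)) (l (P X))))
      (slcomp (F (P (P X))) (l X) (Tmap T (P (P X)) (P X) (Pmult Q X))))"
proof -
  have "Pmap_le Q (F (P (P X))) (F X)
      (slcomp (F (P (P X))) (Pmult Q (F X))
        (slcomp (F (P (P X))) (Pmap Q (F (P X)) (P (F X)) (l X)) (l (P X))))
      (slcomp (F (P (P X))) (l X) (Tmap T (P (P X)) (P X) (Pmult Q X))) \<longleftrightarrow>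
    (\<forall>S\<in>pts (F (P (P X))). \<forall>s\<in>pts (F (P X)). \<forall>a\<in>pts (F X).
      Le Q (fam_at (l (P X) S) s \<cdot> fam_at (l X s) a)
        (fam_at (l X (Tmap T (P (P X)) (P X) (Pmult Q X) S)) a))"
    if X: "X \<in> slices Q" for X
  proof -
    note FX = Tob_closed[OF X] and PX = Pob_closed[OF X]
    note PFX = Pob_closed[OF FX] and FPX = Tob_closed[OF PX] and PPX = Pob_closed[OF PX]
    note lX = law_closed[OF l X] and lPX = law_closed[OF l PX]
    note Ts = Tmap_closed[OF PPX PX Pmult_closed[OF X]]
    have "Le Q (fam_at (Pmult Q (F X) (Pmap Q (F (P X)) (P (F X)) (l X) (l (P X) S))) a)
          (fam_at (l X (Tmap T (P (P X)) (P X) (Pmult Q X) S)) a) \<longleftrightarrow>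
        (\<forall>s\<in>pts (F (P X)). Le Q (fam_at (l (P X) S) s \<cdot> fam_at (l X s) a)
          (fam_at (l X (Tmap T (P (P X)) (P X) (Pmult Q X) S)) a))"
      if S: "S \<in> pts (F (P (P X)))" and a: "a \<in> pts (F X)" for S a
      using law_hom[OF l X smaps_at(1)[OF Ts S] a] smaps_at(2)[OF Ts S] smaps_at[OF lPX S]
      by (intro Pmult_Pmap_le_at_iff[OF FX FPX lX _ a]) (simp_all add: Pob_ar)
    then show ?thesis
      unfolding Pmap_le_iff[OF slcomp_closed[OF slcomp_closed[OF lPX Pmap_closed[OF FPX PFX lX]] Pmult_closed[OF FX]]
          slcomp_closed[OF Ts lX]]
      by (auto simp: compose_eq)
  qed
  then show ?thesis unfolding law_Pmult_def by simp
qed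

lemma law_unit_iff:
  assumes l: "l \<in> law_families"
  shows "law_unit l \<longleftrightarrow> (\<forall>X\<in>slices Q.
    Pmap_le Q (P X) (F X) (Pmap Q X (F X) (unit X)) (slcomp (P X) (l X) (unit (P X))))"
proof -
  have "Pmap_le Q (P X) (F X) (Pmap Q X (F X) (unit X)) (slcomp (P X) (l X) (unit (P X))) \<longleftrightarrow>
      (\<forall>p\<in>pts (P X). \<forall>x\<in>pts X. Le Q (fam_at p x) (fam_at (l X (unit (P X) p)) (unit X x)))"
    if X: "X \<in> slices Q" for X
  proof -
    note FX = Tob_closed[OF X] and PX = Pob_closed[OF X]
    note eX = Tunit_closed[OF X] and ePX = Tunit_closed[OF PX]
    have "(\<forall>a\<in>pts (F X). Le Q (fam_at (Pmap Q X (F X) (unit X) p) a) (fam_at (l X (unit (P X) p)) a)) \<longleftrightarrow>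
        (\<forall>x\<in>pts X. Le Q (fam_at p x) (fam_at (l X (unit (P X) p)) (unit X x)))"
      if p: "p \<in> pts (P X)" for p
    proof (rule Pmap_le_at_iff[OF X FX eX p])
      fix a assume "a \<in> pts (F X)"
      then show "fam_at (l X (unit (P X) p)) a \<in> Hom Q (ar (F X) a) (fam_cod p)"
        using law_hom[OF l X smaps_at(1)[OF ePX p], of a] smaps_at(2)[OF ePX p] Pob_ar[OF p] by simp
    qed
    then show ?thesis
      unfolding Pmap_le_iff[OF Pmap_closed[OF X FX eX] slcomp_closed[OF ePX law_closed[OF l X]]]
      by (simp add: compose_eq)
  qed
  then show ?thesis unfolding law_unit_def by simp
qed

lemma law_mult_iff:
  assumes l: "l \<in> law_families"
  shows "law_mult l \<longleftrightarrow> (\<forall>X\<in>slices Q.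
    Pmap_le Q (F (F (P X))) (F X)
      (slcomp (F (F (P X))) (Pmap Q (F (F X)) (F X) (mult X))
        (slcomp (F (F (P X))) (l (F X)) (Tmap T (F (P X)) (P (F X)) (l X))))
      (slcomp (F (F (P X))) (l X) (mult (P X))))"
proof -
  have "Pmap_le Q (F (F (P X))) (F X)
      (slcomp (F (F (P X))) (Pmap Q (F (F X)) (F X) (mult X))
        (slcomp (F (F (P X))) (l (F X)) (Tmap T (F (P X)) (P (F X)) (l X))))
      (slcomp (F (F (P X))) (l X) (mult (P X))) \<longleftrightarrow>
    (\<forall>S\<in>pts (F (F (P X))). \<forall>A\<in>pts (F (F X)).
      Le Q (fam_at (l (F X) (Tmap T (F (P X)) (P (F X)) (l X) S)) A)
        (fam_at (l X (mult (P X) S)) (mult X A)))"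
    if X: "X \<in> slices Q" for X
  proof -
    note FX = Tob_closed[OF X] and PX = Pob_closed[OF X]
    note FFX = Tob_closed[OF FX] and PFX = Pob_closed[OF FX] and FPX = Tob_closed[OF PX]
    note mX = Tmult_closed[OF X] and mPX = Tmult_closed[OF PX]
    note lX = law_closed[OF l X] and lFX = law_closed[OF l FX]
    note Tl = Tmap_closed[OF FPX PFX lX]
    have "(\<forall>a\<in>pts (F X).
          Le Q (fam_at (Pmap Q (F (F X)) (F X) (mult X) (l (F X) (Tmap T (F (P X)) (P (F X)) (l X) S))) a)
            (fam_at (l X (mult (P X) S)) a)) \<longleftrightarrow>
        (\<forall>A\<in>pts (F (F X)). Le Q (fam_at (l (F X) (Tmap T (F (P X)) (P (F X)) (l X) S)) A)
          (fam_at (l X (mult (P X) S)) (mult X A)))"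
      if S: "S \<in> pts (F (F (P X)))" for S
    proof -
      note TlS = smaps_at[OF Tl S] 
      show ?thesis
      proof (rule Pmap_le_at_iff[OF FFX FX mX smaps_at(1)[OF lFX TlS(1)]])
        fix a assume "a \<in> pts (F X)"
        then show "fam_at (l X (mult (P X) S)) a \<in>
            Hom Q (ar (F X) a) (fam_cod (l (F X) (Tmap T (F (P X)) (P (F X)) (l X) S)))"
          using law_hom[OF l X smaps_at(1)[OF mPX S], of a] smaps_at(2)[OF mPX S] TlS(2)
            smaps_at[OF lFX TlS(1)] by (simp add: Pob_ar)
      qed
    qed
    then show ?thesis
      unfolding Pmap_le_iff[OF slcomp_closed[OF slcomp_closed[OF Tl lFX] Pmap_closed[OF FFX FX mX]]
          slcomp_closed[OF mPX lX]]
      by (simp add: compose_eq)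
  qed
  then show ?thesis unfolding law_mult_def by simp
qed

lemma law_monotone_iff:
  assumes l: "l \<in> law_families"
  shows "law_monotone l \<longleftrightarrow> (\<forall>X\<in>slices Q. \<forall>Y\<in>slices Q. \<forall>f\<in>smaps Y (P X). \<forall>g\<in>smaps Y (P X).
    Pmap_le Q Y X f g \<longrightarrow>
    Pmap_le Q (F Y) (F X) (slcomp (F Y) (l X) (Tmap T Y (P X) f)) (slcomp (F Y) (l X) (Tmap T Y (P X) g)))"
proof -
  have "Pmap_le Q (F Y) (F X) (slcomp (F Y) (l X) (Tmap T Y (P X) f)) (slcomp (F Y) (l X) (Tmap T Y (P X) g)) \<longleftrightarrow>
      (\<forall>b\<in>pts (F Y). \<forall>a\<in>pts (F X).
        Le Q (fam_at (l X (Tmap T Y (P X) f b)) a) (fam_at (l X (Tmap T Y (P X) g b)) a))"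
    if X: "X \<in> slices Q" and Y: "Y \<in> slices Q" and f: "f \<in> smaps Y (P X)" and g: "g \<in> smaps Y (P X)" for X Y f g
    unfolding Pmap_le_iff[OF ext_of_law_map_closed[OF l X Y f] ext_of_law_map_closed[OF l X Y g]]
    by (simp add: compose_eq)
  then show ?thesis unfolding law_monotone_def by simp
qed

lemma monotone_distributive_laws_iff:
  "l \<in> monotone_distributive_laws Q T \<longleftrightarrow> l \<in> law_families \<and>
    law_natural l \<and> law_Punit l \<and> law_Pmult l \<and> law_unit l \<and> law_mult l \<and> law_monotone l"
proof (cases "l \<in> law_families")
  case True
  then show ?thesis
    by (simp only: monotone_distributive_laws_def mem_Collect_eq law_natural_iff law_Punit_iff
        law_Pmult_iff law_unit_iff law_mult_iff law_monotone_iff flip: law_families_def)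
next
  case False
  then show ?thesis
    by (simp add: monotone_distributive_laws_def law_families_def)
qed


section \<open>Laws correspond to lax extensions\<close>

lemma law_monotone_iff_ext:
  assumes l: "l \<in> law_families"
  shows "law_monotone l \<longleftrightarrow> ext_of_law Q T l \<in> monotone_extension_families Q T"
proof
  assume mono: "law_monotone l"
  have "Le Q (ext_of_law Q T l X Y \<phi> a b) (ext_of_law Q T l X Y \<phi>' a b)"
    if X: "X \<in> slices Q" and Y: "Y \<in> slices Q" and \<phi>: "\<phi> \<in> Rel Q X Y" and \<phi>': "\<phi>' \<in> Rel Q X Y"
      and le: "rel_le Q X Y \<phi> \<phi>'" and a: "a \<in> pts (F X)" and b: "b \<in> pts (F Y)" for X Y \<phi> \<phi>' a b
  proof -
    have "Pmap_le Q Y X (larrow X Y \<phi>) (larrow X Y \<phi>')"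
      unfolding Pmap_le_iff[OF larrow_closed[OF Y \<phi>] larrow_closed[OF Y \<phi>']]
      using le by (simp add: larrow_at[OF X] rel_le_def)
    then show ?thesis
      unfolding ext_of_law_at[OF l X Y \<phi> a b] ext_of_law_at[OF l X Y \<phi>' a b]
      using mono X Y larrow_closed[OF Y \<phi>] larrow_closed[OF Y \<phi>'] a b unfolding law_monotone_def by blast
  qed
  then show "ext_of_law Q T l \<in> monotone_extension_families Q T"
    using ext_of_law_closed[OF l] unfolding monotone_extension_families_def rel_le_def[of Q "F X" "F Y" for X Y]
    by blast
next
  assume mono: "ext_of_law Q T l \<in> monotone_extension_families Q T"
  show "law_monotone l"
    unfolding law_monotone_def
  proof (intro ballI impI)
    fix X Y f g b a
    assume X: "X \<in> slices Q" and Y: "Y \<in> slices Q" and f: "f \<in> smaps Y (P X)" and g: "g \<in> smaps Y (P X)"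
      and le: "Pmap_le Q Y X f g" and b: "b \<in> pts (F Y)" and a: "a \<in> pts (F X)"
    have "rel_le Q X Y (rarrow X Y f) (rarrow X Y g)"
      using le unfolding Pmap_le_iff[OF f g] by (simp add: rarrow_at rel_le_def)
    from monotone_extension_at[OF mono X Y rarrow_closed[OF X f] rarrow_closed[OF X g] this a b]
    show "Le Q (fam_at (l X (Tmap T Y (P X) f b)) a) (fam_at (l X (Tmap T Y (P X) g b)) a)"
      by (simp add: ext_of_law_at[OF l X Y rarrow_closed[OF X f] a b]
          ext_of_law_at[OF l X Y rarrow_closed[OF X g] a b] larrow_rarrow[OF X Y] f g)
  qed
qed

lemma law_Punit_iff_ext:
  assumes l: "l \<in> law_families"
  shows "law_Punit l \<longleftrightarrow> lax_identity (ext_of_law Q T l)"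
proof -
  have "ext_of_law Q T l X X (unit_rel X) a a = fam_at (l X (Tmap T X (P X) (Punit Q X) a)) a"
    if X: "X \<in> slices Q" and a: "a \<in> pts (F X)" for X a
    by (simp only: ext_of_law_at[OF l X X upper_star_closed[OF X X sid_closed] a a] Punit_eq_larrow)
  then show ?thesis unfolding law_Punit_def lax_identity_def by simp
qed

text \<open>
  The law axiom is the axiom for the extension at \<open>eps\<close>. From there it reaches \<open>\<phi>\<close> by naturality of
  the unit of \<open>T\<close> at \<open>larrow \<phi>\<close>; the same argument applies to the multiplication below.
\<close>

lemma law_unit_iff_ext:
  assumes l: "l \<in> law_families"
  shows "law_unit l \<longleftrightarrow> lax_unit (ext_of_law Q T l)"
proof
  assume u: "law_unit l"
  show "lax_unit (ext_of_law Q T l)"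
    unfolding lax_unit_def
  proof (intro ballI)
    fix X Y \<phi> x y
    assume X: "X \<in> slices Q" and Y: "Y \<in> slices Q" and \<phi>: "\<phi> \<in> Rel Q X Y" and x: "x \<in> pts X" and y: "y \<in> pts Y"
    note g = larrow_closed[OF Y \<phi>]
    have "Le Q (fam_at (larrow X Y \<phi> y) x) (fam_at (l X (unit (P X) (larrow X Y \<phi> y))) (unit X x))"
      using u X x smaps_at(1)[OF g y] unfolding law_unit_def by blast
    then show "Le Q (\<phi> x y) (ext_of_law Q T l X Y \<phi> (unit X x) (unit Y y))"
      by (simp add: larrow_at[OF X x y] ext_of_law_at[OF l X Y \<phi> unit_at(1)[OF X x] unit_at(1)[OF Y y]]
          Tunit_natural_at[OF Y Pob_closed[OF X] g y])
  qed
next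
  assume u: "lax_unit (ext_of_law Q T l)"
  show "law_unit l"
    unfolding law_unit_def
  proof (intro ballI)
    fix X p x assume X: "X \<in> slices Q" and p: "p \<in> pts (P X)" and x: "x \<in> pts X"
    have "Le Q (eps Q X x p) (ext_of_law Q T l X (P X) (eps Q X) (unit X x) (unit (P X) p))"
      using u X Pob_closed[OF X] eps_closed[OF X] x p unfolding lax_unit_def by blast
    then show "Le Q (fam_at p x) (fam_at (l X (unit (P X) p)) (unit X x))"
      by (simp add: x p law_at[OF l X unit_at(1)[OF Pob_closed[OF X] p] unit_at(1)[OF X x]])
  qed
qed

text \<open>
  The transpose of the extended relation is the law after \<open>T\<close> of a map, so extending it again splits
  off \<open>T\<close> of the law as it occurs in the multiplication axiom.
\<close>

lemma ext_of_law_twice_at: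
  assumes l: "l \<in> law_families" and X: "X \<in> slices Q" and Y: "Y \<in> slices Q" and \<phi>: "\<phi> \<in> Rel Q X Y"
    and A: "A \<in> pts (F (F X))" and B: "B \<in> pts (F (F Y))"
  shows "ext_of_law Q T l (F X) (F Y) (ext_of_law Q T l X Y \<phi>) A B =
    fam_at (l (F X) (Tmap T (F (P X)) (P (F X)) (l X)
      (Tmap T (F Y) (F (P X)) (Tmap T Y (P X) (larrow X Y \<phi>)) B))) A"
proof -
  note FX = Tob_closed[OF X] and FY = Tob_closed[OF Y] and PX = Pob_closed[OF X]
  note E\<phi> = extension_closed[OF ext_of_law_closed[OF l] X Y \<phi>]
  show ?thesis
    unfolding ext_of_law_at[OF l FX FY E\<phi> A B] larrow_ext_of_law[OF l X Y \<phi>]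
      Tmap_comp_at[OF FY Tob_closed[OF PX] Pob_closed[OF FX] Tmap_closed[OF Y PX larrow_closed[OF Y \<phi>]]
        law_closed[OF l X] B] ..
qed

lemma law_mult_iff_ext:
  assumes l: "l \<in> law_families"
  shows "law_mult l \<longleftrightarrow> lax_mult (ext_of_law Q T l)"
proof
  assume m: "law_mult l"
  show "lax_mult (ext_of_law Q T l)"
    unfolding lax_mult_def
  proof (intro ballI)
    fix X Y \<phi> A B
    assume X: "X \<in> slices Q" and Y: "Y \<in> slices Q" and \<phi>: "\<phi> \<in> Rel Q X Y"
      and A: "A \<in> pts (F (F X))" and B: "B \<in> pts (F (F Y))"
    note PX = Pob_closed[OF X] and g = larrow_closed[OF Y \<phi>]
    let ?S = "Tmap T (F Y) (F (P X)) (Tmap T Y (P X) (larrow X Y \<phi>)) B"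
    have "?S \<in> pts (F (F (P X)))"
      by (rule Tmap_at(1)[OF Tob_closed[OF Y] Tob_closed[OF PX] Tmap_closed[OF Y PX g] B])
    then have "Le Q (fam_at (l (F X) (Tmap T (F (P X)) (P (F X)) (l X) ?S)) A)
        (fam_at (l X (mult (P X) ?S)) (mult X A))"
      using m X A unfolding law_mult_def by blast
    then show "Le Q (ext_of_law Q T l (F X) (F Y) (ext_of_law Q T l X Y \<phi>) A B)
        (ext_of_law Q T l X Y \<phi> (mult X A) (mult Y B))"
      by (simp only: ext_of_law_twice_at[OF l X Y \<phi> A B]
          ext_of_law_at[OF l X Y \<phi> mult_at(1)[OF X A] mult_at(1)[OF Y B]] Tmult_natural_at[OF Y PX g B])
  qed
next
  assume m: "lax_mult (ext_of_law Q T l)"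
  show "law_mult l"
    unfolding law_mult_def
  proof (intro ballI)
    fix X S A assume X: "X \<in> slices Q" and S: "S \<in> pts (F (F (P X)))" and A: "A \<in> pts (F (F X))"
    note PX = Pob_closed[OF X] and eps = eps_closed[OF X]
    have "Tmap T (F (P X)) (F (P X)) (Tmap T (P X) (P X) (larrow X (P X) (eps Q X))) S = S"
      by (simp add: larrow_eps[OF X] Tmap_id[OF PX] Tmap_id_at[OF Tob_closed[OF PX] S])
    moreover have "Le Q (ext_of_law Q T l (F X) (F (P X)) (ext_of_law Q T l X (P X) (eps Q X)) A S)
        (ext_of_law Q T l X (P X) (eps Q X) (mult X A) (mult (P X) S))"
      using m X PX eps A S unfolding lax_mult_def by blast
    ultimately show "Le Q (fam_at (l (F X) (Tmap T (F (P X)) (P (F X)) (l X) S)) A)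
        (fam_at (l X (mult (P X) S)) (mult X A))"
      by (simp add: ext_of_law_twice_at[OF l X PX eps A S]
          law_at[OF l X mult_at(1)[OF PX S] mult_at(1)[OF X A]])
  qed
qed

text \<open>
  Naturality at the transpose of \<open>\<phi>\<close> moves the value for \<open>\<psi>\<close> into the presheaves over \<open>P X\<close>. There the
  two factors meet in the form required by the multiplication axiom, whose right-hand side is the law
  at the Kleisli composite of the transposes. By monotonicity of the law it suffices to compare that
  composite with the transpose of the composite relation.
\<close>

lemma lax_composition_ext_of_law:
  assumes l: "l \<in> law_families" and "law_natural l" and "law_Pmult l" and "law_monotone l"
  shows "lax_composition (ext_of_law Q T l)"
  unfolding lax_composition_def
proof (intro ballI)
  fix X Y Z \<phi> \<psi> a b c
  assume X: "X \<in> slices Q" and Y: "Y \<in> slices Q" and Z: "Z \<in> slices Q"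
    and \<phi>: "\<phi> \<in> Rel Q X Y" and \<psi>: "\<psi> \<in> Rel Q Y Z"
    and a: "a \<in> pts (F X)" and b: "b \<in> pts (F Y)" and c: "c \<in> pts (F Z)"
  note PX = Pob_closed[OF X] and PY = Pob_closed[OF Y]
  note PPX = Pob_closed[OF PX]
  (* q and s are the points at which the two factors evaluate l; S is s moved along the transpose f
     of \<phi>, which brings both factors into the shape to which law_Pmult applies. *)
  define f where "f = larrow X Y \<phi>"
  define g where "g = larrow Y Z \<psi>"
  define k where "k = slcomp Z (Pmult Q X) (slcomp Z (Pmap Q Y (P X) f) g)"
  define r where "r = rcomp Q X Y Z \<psi> \<phi>"
  define s where "s = Tmap T Z (P Y) g c"
  define S where "S = Tmap T (P Y) (P (P X)) (Pmap Q Y (P X) f) s"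
  define q where "q = Tmap T Y (P X) f b"
  have f: "f \<in> smaps Y (P X)" and g: "g \<in> smaps Z (P Y)"
    unfolding f_def g_def using X Y Z \<phi> \<psi> by (auto intro: larrow_closed)
  have r: "r \<in> Rel Q X Z" unfolding r_def using X Z \<phi> \<psi> by (rule rcomp_closed)
  note Pf = Pmap_closed[OF Y PX f]
  note Pfg = slcomp_closed[OF g Pf]
  have k: "k \<in> smaps Z (P X)" unfolding k_def by (rule slcomp_closed[OF Pfg Pmult_closed[OF X]])
  have s: "s \<in> pts (F (P Y))" "ar (F (P Y)) s = ar (F Z) c"
    unfolding s_def by (rule Tmap_at[OF Z PY g c])+
  have S: "S \<in> pts (F (P (P X)))" "ar (F (P (P X))) S = ar (F Z) c"
    unfolding S_def using Tmap_at[OF PY PPX Pf s(1)] s(2) by auto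
  have q: "q \<in> pts (F (P X))" "ar (F (P X)) q = ar (F Y) b"
    unfolding q_def by (rule Tmap_at[OF Y PX f b])+
  have Tk: "Tmap T (P (P X)) (P X) (Pmult Q X) S = Tmap T Z (P X) k c"
    unfolding k_def S_def s_def
    by (simp only: Tmap_comp_at[OF Z PPX PX Pfg Pmult_closed[OF X] c] Tmap_comp_at[OF Z PY PPX g Pf c])
  note kc = Tmap_at[OF Z PX k c] and rc = Tmap_at[OF Z PX larrow_closed[OF Z r] c]
  \<comment> \<open>The Kleisli composite of the transposes of \<open>\<phi>\<close> and \<open>\<psi>\<close> lies below the transpose of their composite.\<close>
  have "Pmap_le Q Z X k (larrow X Z r)"
    unfolding Pmap_le_iff[OF k larrow_closed[OF Z r]]
  proof (intro ballI)
    fix z x assume z: "z \<in> pts Z" and x: "x \<in> pts X"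
    note gz = smaps_at[OF g z]
    have "rel_le Q X Z (rcomp Q X Y Z \<psi> \<phi>) r"
      unfolding r_def rel_le_def using Le_refl[OF Rel_at[OF r]] by (simp add: r_def)
    then have "\<forall>y\<in>pts Y. Le Q (\<psi> y z \<cdot> \<phi> x y) (r x z)"
      using x z unfolding rcomp_le_iff[OF \<phi> \<psi> r] by blast
    then have "Le Q (fam_at (Pmult Q X (Pmap Q Y (P X) f (g z))) x) (r x z)"
      using Rel_at[OF r x z] gz x z
      by (subst Pmult_Pmap_le_at_iff[OF X Y f gz(1) x])
        (simp_all add: Pob_ar f_def g_def larrow_at[OF X] larrow_at[OF Y])
    then show "Le Q (fam_at (k z) x) (fam_at (larrow X Z r z) x)"
      using x z by (simp add: k_def compose_eq larrow_at[OF X])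
  qed
  then have mono: "Le Q (fam_at (l X (Tmap T Z (P X) k c)) a) (fam_at (l X (Tmap T Z (P X) (larrow X Z r) c)) a)"
    using assms(4) X Z k larrow_closed[OF Z r] a c unfolding law_monotone_def by blast
  have nat: "Le Q (fam_at (l Y s) b) (fam_at (l (P X) S) q)"
    using assms(2) Y PX f s(1) b unfolding law_natural_def S_def q_def by blast
  have mult: "Le Q (fam_at (l (P X) S) q \<cdot> fam_at (l X q) a) (fam_at (l X (Tmap T Z (P X) k c)) a)"
    using assms(3) X S(1) q(1) a unfolding law_Pmult_def Tk[symmetric] by blast
  have u: "fam_at (l X q) a \<in> Hom Q (ar (F X) a) (ar (F Y) b)"
    and v: "fam_at (l Y s) b \<in> Hom Q (ar (F Y) b) (ar (F Z) c)"
    and v': "fam_at (l (P X) S) q \<in> Hom Q (ar (F Y) b) (ar (F Z) c)"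
    and w: "fam_at (l X (Tmap T Z (P X) k c)) a \<in> Hom Q (ar (F X) a) (ar (F Z) c)"
    and w': "fam_at (l X (Tmap T Z (P X) (larrow X Z r) c)) a \<in> Hom Q (ar (F X) a) (ar (F Z) c)"
    using law_hom[OF l X q(1) a] law_hom[OF l Y s(1) b] law_hom[OF l PX S(1) q(1)]
      law_hom[OF l X kc(1) a] law_hom[OF l X rc(1) a] q(2) s(2) S(2) kc(2) rc(2) by simp_all
  have "Le Q (fam_at (l Y s) b \<cdot> fam_at (l X q) a) (fam_at (l X (Tmap T Z (P X) (larrow X Z r) c)) a)"
    using Comp_mono_left[OF nat u v v'] Le_trans[OF mult mono Comp_closed[OF u v'] w w']
      Comp_closed[OF u v] Comp_closed[OF u v'] w' by (rule Le_trans)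
  then show "Le Q (ext_of_law Q T l Y Z \<psi> b c \<cdot> ext_of_law Q T l X Y \<phi> a b)
      (ext_of_law Q T l X Z (rcomp Q X Y Z \<psi> \<phi>) a c)"
    unfolding r_def[symmetric]
    by (simp only: ext_of_law_at[OF l Y Z \<psi> b c] ext_of_law_at[OF l X Y \<phi> a b] ext_of_law_at[OF l X Z r a c]
        s_def q_def f_def g_def)
qed

text \<open>
  A component of a presheaf lies below the component of its direct image at the image point. This
  bounds \<open>eps\<close> on \<open>X\<close> along \<open>f\<close> by a restriction of \<open>eps\<close> on \<open>Y\<close>.
\<close>

lemma law_natural_if_lax_extension:
  assumes l: "l \<in> law_families" and lax: "ext_of_law Q T l \<in> lax_extensions Q T"
  shows "law_natural l"
  unfolding law_natural_def
proof (intro ballI)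
  let ?E = "ext_of_law Q T l"
  fix X Y f s a
  assume X: "X \<in> slices Q" and Y: "Y \<in> slices Q" and f: "f \<in> smaps X Y"
    and s: "s \<in> pts (F (P X))" and a: "a \<in> pts (F X)"
  note PX = Pob_closed[OF X] and PY = Pob_closed[OF Y] and Pf = Pmap_closed[OF X Y f]
  note Tfa = Tmap_at[OF X Y f a] and Ts = Tmap_at[OF PX PY Pf s]
  let ?r = "rcomp Q Y (P Y) (P X) (upper_star Q (P X) (P Y) (Pmap Q X Y f)) (eps Q Y)"
  have r: "?r \<in> Rel Q Y (P X)" by (rule restriction_closed[OF Y PY PX eps_closed[OF Y] Pf])
  have E: "?E \<in> monotone_extension_families Q T" "lax_composition ?E" "preserves_upper_stars ?E"
    using lax by (simp_all add: lax_extensions_iff_preserves_stars)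
  have com: "commutes_with_restriction ?E"
    using lax by (simp add: lax_extensions_iff)
  (* The transpose of ?r is the direct image along f. *)
  have le: "Le Q (eps Q X x p) (?r (f x) p)" if x: "x \<in> pts X" and p: "p \<in> pts (P X)" for x p
  proof -
    note q = smaps_at[OF Pf p]
    have "\<forall>y\<in>pts Y. fam_at (Pmap Q X Y f p) y \<in> Hom Q (ar Y y) (fam_cod p)"
      using Pob_at'[OF Y q(1)] q(2) Pob_ar[OF p] by simp
    moreover from this have "\<forall>y\<in>pts Y. Le Q (fam_at (Pmap Q X Y f p) y) (fam_at (Pmap Q X Y f p) y)"
      using Le_refl by blast
    ultimately have "Le Q (fam_at p x) (fam_at (Pmap Q X Y f p) (f x))"
      using Pmap_le_at_iff[OF X Y f p, of "fam_at (Pmap Q X Y f p)"] x by simp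
    then show ?thesis
      using x p q(1) smaps_at(1)[OF f x]
      by (simp add: rcomp_upper_star_at[OF Y PY PX eps_closed[OF Y] Pf smaps_at(1)[OF f x] p])
  qed
  have "Le Q (?E X (P X) (eps Q X) a s) (?E Y (P X) ?r (Tmap T X Y f a) s)"
    by (rule extension_le_along_source[OF E X Y PX f eps_closed[OF X] r le a s])
  also have "?E Y (P X) ?r (Tmap T X Y f a) s =
      ?E Y (P Y) (eps Q Y) (Tmap T X Y f a) (Tmap T (P X) (P Y) (Pmap Q X Y f) s)"
    using com Y PY PX eps_closed[OF Y] Pf Tfa(1) s
    unfolding commutes_with_restriction_iff[OF ext_of_law_closed[OF l]] by blast
  finally show "Le Q (fam_at (l X s) a) (fam_at (l Y (Tmap T (P X) (P Y) (Pmap Q X Y f) s)) (Tmap T X Y f a))"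
    by (simp only: law_at[OF l X s a] law_at[OF l Y Ts(1) Tfa(1)])
qed

lemma law_Pmult_if_lax_extension:
  assumes l: "l \<in> law_families" and lax: "ext_of_law Q T l \<in> lax_extensions Q T"
  shows "law_Pmult l"
  unfolding law_Pmult_def
proof (intro ballI)
  let ?E = "ext_of_law Q T l"
  fix X S s a
  assume X: "X \<in> slices Q" and S: "S \<in> pts (F (P (P X)))" and s: "s \<in> pts (F (P X))" and a: "a \<in> pts (F X)"
  note PX = Pob_closed[OF X] and mu = Pmult_closed[OF X]
  note PPX = Pob_closed[OF PX] and eX = eps_closed[OF X] and ePX = eps_closed[OF PX]
  note TS = Tmap_at[OF PPX PX mu S]
  let ?r = "rcomp Q X (P X) (P (P X)) (upper_star Q (P (P X)) (P X) (Pmult Q X)) (eps Q X)"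
  have r: "?r \<in> Rel Q X (P (P X))" by (rule restriction_closed[OF X PX PPX eX mu])
  have E: "?E \<in> monotone_extension_families Q T" "lax_composition ?E" "commutes_with_restriction ?E"
    using lax by (simp_all add: lax_extensions_iff)
  (* The transpose of ?r is Pmult, a supremum of the terms of the composite of the two evaluation
     relations. *)
  have "rel_le Q X (P (P X)) (rcomp Q X (P X) (P (P X)) (eps Q (P X)) (eps Q X)) ?r"
    unfolding rcomp_le_iff[OF eX ePX r]
  proof (intro ballI)
    fix x p R assume x: "x \<in> pts X" and p: "p \<in> pts (P X)" and R: "R \<in> pts (P (P X))"
    note q = smaps_at[OF mu R]
    have "fam_at (Pmult Q X R) x \<in> Hom Q (ar X x) (fam_cod R)"
      using Pob_at'[OF X q(1) x] q(2) Pob_ar[OF R] by simp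
    then have "Le Q (fam_at R p \<cdot> fam_at p x) (fam_at (Pmult Q X R) x)"
      using Pmult_le_at_iff[OF X R x] Le_refl p by blast
    then show "Le Q (eps Q (P X) p R \<cdot> eps Q X x p) (?r x R)"
      using x p R q(1) by (simp add: rcomp_upper_star_at[OF X PX PPX eX mu x R])
  qed
  then have "Le Q (?E (P X) (P (P X)) (eps Q (P X)) s S \<cdot> ?E X (P X) (eps Q X) a s) (?E X (P (P X)) ?r a S)"
    by (rule lax_composition_le[OF E(1,2) X PX PPX eX ePX r _ a s S])
  also have "?E X (P (P X)) ?r a S = ?E X (P X) (eps Q X) a (Tmap T (P (P X)) (P X) (Pmult Q X) S)"
    using E(3) X PX PPX eX mu a S
    unfolding commutes_with_restriction_iff[OF ext_of_law_closed[OF l]] by blast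
  finally show "Le Q (fam_at (l (P X) S) s \<cdot> fam_at (l X s) a)
      (fam_at (l X (Tmap T (P (P X)) (P X) (Pmult Q X) S)) a)"
    by (simp only: law_at[OF l PX S s] law_at[OF l X s a] law_at[OF l X TS(1) a])
qed

lemma law_iff_lax_extension:
  assumes l: "l \<in> law_families"
  shows "l \<in> monotone_distributive_laws Q T \<longleftrightarrow> ext_of_law Q T l \<in> lax_extensions Q T"
proof
  assume "l \<in> monotone_distributive_laws Q T"
  then show "ext_of_law Q T l \<in> lax_extensions Q T"
    using l lax_composition_ext_of_law[OF l] ext_of_law_commutes[OF l]
    by (simp add: monotone_distributive_laws_iff lax_extensions_iff law_monotone_iff_ext
        law_Punit_iff_ext law_unit_iff_ext law_mult_iff_ext)
next
  assume lax: "ext_of_law Q T l \<in> lax_extensions Q T"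
  then show "l \<in> monotone_distributive_laws Q T"
    using l law_natural_if_lax_extension[OF l lax] law_Pmult_if_lax_extension[OF l lax]
    by (simp add: monotone_distributive_laws_iff lax_extensions_iff law_monotone_iff_ext
        law_Punit_iff_ext law_unit_iff_ext law_mult_iff_ext)
qed

lemma ext_of_law_lax_extension:
  assumes "l \<in> monotone_distributive_laws Q T"
  shows "ext_of_law Q T l \<in> lax_extensions Q T"
  using assms law_iff_lax_extension[of l] monotone_distributive_laws_iff[of l] by blast

lemma ext_of_law_law_of_lax_extension:
  assumes "E \<in> lax_extensions Q T"
  shows "ext_of_law Q T (law_of_ext Q T E) = E"
  using assms monotone_extension by (auto simp: lax_extensions_iff intro: ext_of_law_law_of_ext)

lemma law_of_ext_monotone_law:
  assumes "E \<in> lax_extensions Q T"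
  shows "law_of_ext Q T E \<in> monotone_distributive_laws Q T"
proof -
  have "E \<in> extension_families Q T"
    using assms monotone_extension by (simp add: lax_extensions_iff)
  then show ?thesis
    using law_iff_lax_extension[OF law_of_ext_closed] ext_of_law_law_of_lax_extension[OF assms] assms by simp
qed

lemma bij_betw_ext_of_law:
  "bij_betw (ext_of_law Q T) (monotone_distributive_laws Q T) (lax_extensions Q T)"
  by (rule bij_betw_byWitness[where f' = "law_of_ext Q T"])
    (use ext_of_law_lax_extension law_of_ext_monotone_law law_of_ext_ext_of_law
        ext_of_law_law_of_lax_extension in
      \<open>auto simp: monotone_distributive_laws_iff\<close>)

end


section \<open>The correspondence\<close>

theorem theorem6p5:
  fixes Q :: "('v::set_universe, 'v) quantaloid" and T :: "'v slice_monad"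
  assumes "small_quantaloid Q" and "slice_monad Q T"
  shows
    "bij_betw (ext_of_law Q T) (monotone_distributive_laws Q T) (lax_extensions Q T) \<and>
     (\<forall>l\<in>monotone_distributive_laws Q T.
        \<forall>X\<in>slices Q. \<forall>Y\<in>slices Q. \<forall>\<phi>\<in>Rel Q X Y.
          larrow (Tob T X) (Tob T Y) (ext_of_law Q T l X Y \<phi>) =
          slcomp (Tob T Y) (l X) (Tmap T Y (Pob Q X) (larrow X Y \<phi>))) \<and>
     (\<forall>l\<in>monotone_distributive_laws Q T. law_of_ext Q T (ext_of_law Q T l) = l) \<and>
     (\<forall>E\<in>lax_extensions Q T.
        law_of_ext Q T E \<in> monotone_distributive_laws Q T \<and>
        ext_of_law Q T (law_of_ext Q T E) = E) \<and>
     lax_extensions Q T =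
       {E \<in> monotone_extension_families Q T.
         (\<forall>X\<in>slices Q. \<forall>Y\<in>slices Q. \<forall>f\<in>smaps X Y.
            rel_le Q (Tob T X) (Tob T Y)
              (lower_star Q (Tob T X) (Tob T Y) (Tmap T X Y f))
              (E X Y (lower_star Q X Y f))) \<and>
         (\<forall>X\<in>slices Q. \<forall>Y\<in>slices Q. \<forall>f\<in>smaps X Y.
            rel_le Q (Tob T Y) (Tob T X)
              (upper_star Q (Tob T X) (Tob T Y) (Tmap T X Y f))
              (E Y X (upper_star Q X Y f))) \<and>
         (\<forall>X\<in>slices Q. \<forall>Y\<in>slices Q. \<forall>Z\<in>slices Q. \<forall>\<phi>\<in>Rel Q X Y. \<forall>\<psi>\<in>Rel Q Y Z.
            rel_le Q (Tob T X) (Tob T Z)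
              (rcomp Q (Tob T X) (Tob T Y) (Tob T Z) (E Y Z \<psi>) (E X Y \<phi>))
              (E X Z (rcomp Q X Y Z \<psi> \<phi>))) \<and>
         (\<forall>X\<in>slices Q. \<forall>Y\<in>slices Q. \<forall>\<phi>\<in>Rel Q X Y.
            rel_le Q X (Tob T Y)
              (rcomp Q X Y (Tob T Y) (lower_star Q Y (Tob T Y) (Tunit T Y)) \<phi>)
              (rcomp Q X (Tob T X) (Tob T Y) (E X Y \<phi>) (lower_star Q X (Tob T X) (Tunit T X)))) \<and>
         (\<forall>X\<in>slices Q. \<forall>Y\<in>slices Q. \<forall>\<phi>\<in>Rel Q X Y.
            rel_le Q (Tob T (Tob T X)) (Tob T Y)
              (rcomp Q (Tob T (Tob T X)) (Tob T (Tob T Y)) (Tob T Y)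
                (lower_star Q (Tob T (Tob T Y)) (Tob T Y) (Tmult T Y))
                (E (Tob T X) (Tob T Y) (E X Y \<phi>)))
              (rcomp Q (Tob T (Tob T X)) (Tob T X) (Tob T Y)
                (E X Y \<phi>) (lower_star Q (Tob T (Tob T X)) (Tob T X) (Tmult T X))))}"
  (is "_ \<and> _ \<and> _ \<and> _ \<and> _ = ?R")
proof -
  interpret monad_over_quantaloid Q T
    using assms by (rule monad_over_quantaloid.intro)
  have law: "l \<in> law_families" if "l \<in> monotone_distributive_laws Q T" for l
    using that by (simp add: monotone_distributive_laws_iff)
  have "E \<in> lax_extensions Q T \<longleftrightarrow> E \<in> ?R" for E
  proof (cases "E \<in> monotone_extension_families Q T")
    case True
    then have "E \<in> extension_families Q T" by (rule monotone_extension)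
    then show ?thesis
      by (simp only: lax_extensions_iff_preserves_stars True mem_Collect_eq preserves_lower_stars_iff
          preserves_upper_stars_iff lax_composition_iff lax_unit_iff_lower_stars lax_mult_iff_lower_stars)
  qed (simp add: lax_extensions_def)
  then have "lax_extensions Q T = ?R" by blast
  moreover note bij_betw_ext_of_law
  ultimately show ?thesis
    by (intro conjI ballI larrow_ext_of_law law_of_ext_ext_of_law law
        law_of_ext_monotone_law ext_of_law_law_of_lax_extension)
qed

end
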